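(* Let $N\in\mathbb{N}$, $\alpha\in(0,2)$. Let $D_0,D_1\subset\mathbb{R}^N$ be open sets such that $0\in D_1$, $\overline{D}_1\subset D_0$, and $D_0\setminus\overline{D}_1$ satisfies a uniform exterior cone condition, and let $f:(D_0\setminus\overline{D}_1)\times[0,1]\to\mathbb{R}$. Consider the problem $$(P)\qquad -(-\Delta)^{\alpha/2}u=f(x,u)\ \text{ in } D_0\setminus\overline{D}_1,\qquad u=0\ \text{ in }\mathbb{R}^N\setminus D_0,\qquad u=1\ \text{ in }\overline{D}_1 .$$ Consider the following conditions on $f$: - (F0) $f$ is a bounded Borel function on $(D_0\setminus\overline{D}_1)\times[0,1]$; - (F1) $t^{\alpha}f(tx,u)\ge f(x,u)$ for every $t\ge1$ and $(x,u)\in(D_0\setminus\overline{D}_1)\times[0,1]$ such that $tx\in D_0\setminus\overline{D}_1$; - (F2) there exists $C>0$ such that $|f(x,u_1)-f(x,u_2)|\le C|u_1-u_2|$ for all $x\in D_0\setminus\overline{D}_1$ and $u_1,u_2\in[0,1]$; - (F3) $f(x,u_1)\le f(x,u_2)$ for all $x\in D_0\setminus\overline{D}_1$ and $u_1,u_2\in[0,1]$ with $u_1<u_2$. For a function $u$ put $U(\ell)=\{x\in\mathbb{R}^N: u(x)\ge\ell\}$. Then: (i) Assume $D_0$ and $D_1$ are bounded starshaped sets and $f$ satisfies (F0), (F1), (F2), (F3). If $u$ is a solution of $(P)$ such that $0\le u\le1$ on $D_0\setminus\overline{D}_1$, then the superlevel sets $U(\ell)$ are starshaped for all $\ell\in(0,1)$.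 (ii) Assume $D_0$ and $D_1$ are bounded, strictly starshaped sets and $f$ satisfies (F0), (F1), (F2). If $u$ is a solution of $(P)$ such that $0<u<1$ on $D_0\setminus\overline{D}_1$, then the superlevel sets $U(\ell)$ are strictly starshaped for all $\ell\in(0,1)$. (iii) Assume $D_0=\mathbb{R}^N$, $D_1$ is a bounded starshaped set, and $f$ satisfies (F0), (F1), (F2), (F3). If $u$ is a solution of $(P)$ such that $0\le u\le1$ on $D_0\setminus\overline{D}_1$, then the superlevel sets $U(\ell)$ are starshaped for all $\ell\in(0,1)$.
   Context: Let $\mathcal{L}^1_\alpha$ be the space of Borel functions $u:\mathbb{R}^N\to\mathbb{R}\cup\{\infty\}$ with $\int_{\mathbb{R}^N}\frac{|u(x)|}{(1+|x|)^{N+\alpha}}\,dx<\infty$. For $u\in\mathcal{L}^1_\alpha$ and $x\in\mathbb{R}^N$, the fractional Laplacian is $$(-\Delta)^{\alpha/2}u(x)=c_{N,\alpha}\lim_{\varepsilon\downarrow0}\int_{|x-y|>\varepsilon}\frac{u(x)-u(y)}{|x-y|^{N+\alpha}}\,dy$$ whenever the limit exists, with $c_{N,\alpha}=2^{\alpha-2}\pi^{-N/2}\alpha(2-\alpha)\Gamma(\frac{N+\alpha}{2})/\Gamma(2-\frac{\alpha}{2})$. It exists everywhere for functions in $C_c^2(\mathbb{R}^N)$. For $u\in\mathcal{L}^1_\alpha$ the distribution $(-\Delta)^{\alpha/2}u$ is defined by $\langle(-\Delta)^{\alpha/2}u,\varphi\rangle=\int_{\mathbb{R}^N}u\,(-\Delta)^{\alpha/2}\varphi\,dx$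 for $\varphi\in C_c^\infty(\mathbb{R}^N)$. A solution of $(P)$ is a function $u$ that is continuous and bounded on $\mathbb{R}^N$, with $u=0$ in $\mathbb{R}^N\setminus D_0$, $u=1$ in $\overline{D}_1$, and $-(-\Delta)^{\alpha/2}u=f(x,u)$ as distributions in $D_0\setminus\overline{D}_1$, i.e. $\langle-(-\Delta)^{\alpha/2}u,\varphi\rangle=\int f(x,u(x))\varphi(x)\,dx$ for all $\varphi\in C_c^\infty(D_0\setminus\overline{D}_1)$. A set $A\subset\mathbb{R}^N$ is starshaped (with respect to $0$) if $sA\subseteq A$ for every $s\in[0,1]$. It is strictly starshaped if $0$ is in the interior of $A$ and any ray starting from $0$ intersects the boundary of $A$ in only one point. *)

theory Defs
  imports "HOL-Analysis.Analysis"
begin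

definition c_frac :: "nat \<Rightarrow> real \<Rightarrow> real" where
  "c_frac N \<alpha> = 2 powr (\<alpha> - 2) * pi powr (- real N / 2) * \<alpha> * (2 - \<alpha>)
     * Gamma ((real N + \<alpha>) / 2) / Gamma (2 - \<alpha> / 2)"

text \<open>The principal-value fractional Laplacian, as a total function: its value is unspecified
  where the limit does not exist. Below it is only applied to functions in \<open>C_c^\<infinity>\<close>,
  for which the limit exists everywhere.\<close>

definition frac_laplacian :: "real \<Rightarrow> (real^'n \<Rightarrow> real) \<Rightarrow> real^'n \<Rightarrow> real" where
  "frac_laplacian \<alpha> u x = c_frac CARD('n) \<alpha> *
     Lim (at_right 0) (\<lambda>\<epsilon>. LINT y:{y. norm (x - y) > \<epsilon>}|lborel.
        (u x - u y) / norm (x - y) powr (real CARD('n) + \<alpha>))"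

primrec Ck :: "nat \<Rightarrow> (real^'n \<Rightarrow> real) \<Rightarrow> bool" where
  "Ck 0 g \<longleftrightarrow> continuous_on UNIV g"
| "Ck (Suc k) g \<longleftrightarrow>
     (\<forall>x. g differentiable (at x)) \<and> (\<forall>v. Ck k (\<lambda>x. frechet_derivative g (at x) v))"

definition test_function :: "(real^'n) set \<Rightarrow> (real^'n \<Rightarrow> real) \<Rightarrow> bool" where
  "test_function \<Omega> \<phi> \<longleftrightarrow> (\<forall>k. Ck k \<phi>) \<and>
     compact (closure {x. \<phi> x \<noteq> 0}) \<and> closure {x. \<phi> x \<noteq> 0} \<subseteq> \<Omega>"

text \<open>The distribution \<open>(-\<Delta>)^(\<alpha>/2) u\<close> applied to a test function; the integral
  converges absolutely whenever \<open>u / (1 + |x|)^(N + \<alpha>)\<close> is integrable, in particular for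
  continuous bounded \<open>u\<close>.\<close>

definition frac_laplacian_dist ::
    "real \<Rightarrow> (real^'n \<Rightarrow> real) \<Rightarrow> (real^'n \<Rightarrow> real) \<Rightarrow> real" where
  "frac_laplacian_dist \<alpha> u \<phi> = (LINT x|lborel. u x * frac_laplacian \<alpha> \<phi> x)"

text \<open>The nonlinearity \<open>f\<close> is a total function, but only its values on
  \<open>(D0 - closure D1) \<times> {0..1}\<close> are meaningful, so this notion is intended for \<open>u\<close> with
  values in \<open>{0..1}\<close> on \<open>D0 - closure D1\<close>.\<close>

definition solution_P :: "real \<Rightarrow> (real^'n) set \<Rightarrow> (real^'n) set \<Rightarrow>
    (real^'n \<Rightarrow> real \<Rightarrow> real) \<Rightarrow> (real^'n \<Rightarrow> real) \<Rightarrow> bool" where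
  "solution_P \<alpha> D0 D1 f u \<longleftrightarrow>
     continuous_on UNIV u \<and> bounded (range u) \<and>
     (\<forall>x. x \<notin> D0 \<longrightarrow> u x = 0) \<and> (\<forall>x\<in>closure D1. u x = 1) \<and>
     (\<forall>\<phi>. test_function (D0 - closure D1) \<phi> \<longrightarrow>
        - frac_laplacian_dist \<alpha> u \<phi> = (LINT x:(D0 - closure D1)|lborel. f x (u x) * \<phi> x))"

text \<open>Closed finite right circular cone with vertex \<open>z\<close>, axis direction \<open>e\<close> (a unit vector),
  half-opening angle \<open>\<theta>\<close> and length \<open>h\<close>.\<close>

definition finite_cone :: "real^'n \<Rightarrow> real^'n \<Rightarrow> real \<Rightarrow> real \<Rightarrow> (real^'n) set" where
  "finite_cone z e \<theta> h = {y. norm (y - z) \<le> h \<and> cos \<theta> * norm (y - z) \<le> (y - z) \<bullet> e}"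

definition uniform_exterior_cone :: "(real^'n) set \<Rightarrow> bool" where
  "uniform_exterior_cone \<Omega> \<longleftrightarrow>
     (\<exists>\<theta> h. 0 < \<theta> \<and> \<theta> < pi / 2 \<and> 0 < h \<and>
        (\<forall>z\<in>frontier \<Omega>. \<exists>e. norm e = 1 \<and> finite_cone z e \<theta> h \<inter> closure \<Omega> = {z}))"

definition starshaped :: "(real^'n) set \<Rightarrow> bool" where
  "starshaped A \<longleftrightarrow> (\<forall>s\<in>{0..1}. (\<lambda>x. s *\<^sub>R x) ` A \<subseteq> A)"

definition strictly_starshaped :: "(real^'n) set \<Rightarrow> bool" where
  "strictly_starshaped A \<longleftrightarrow> 0 \<in> interior A \<and>
     (\<forall>v. v \<noteq> 0 \<longrightarrow> (\<exists>!y. y \<in> {s *\<^sub>R v | s. 0 \<le> s} \<and> y \<in> frontier A))"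

definition superlevel :: "(real^'n \<Rightarrow> real) \<Rightarrow> real \<Rightarrow> (real^'n) set" where
  "superlevel u l = {x. l \<le> u x}"

definition F0 :: "(real^'n) set \<Rightarrow> (real^'n \<Rightarrow> real \<Rightarrow> real) \<Rightarrow> bool" where
  "F0 \<Omega> f \<longleftrightarrow>
     case_prod f \<in> borel_measurable (restrict_space borel (\<Omega> \<times> {0..1})) \<and>
     bounded (case_prod f ` (\<Omega> \<times> {0..1}))"

definition F1 :: "real \<Rightarrow> (real^'n) set \<Rightarrow> (real^'n \<Rightarrow> real \<Rightarrow> real) \<Rightarrow> bool" where
  "F1 \<alpha> \<Omega> f \<longleftrightarrow> (\<forall>t\<ge>1. \<forall>x\<in>\<Omega>. \<forall>u\<in>{0..1}. t *\<^sub>R x \<in> \<Omega> \<longrightarrow>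
     t powr \<alpha> * f (t *\<^sub>R x) u \<ge> f x u)"

definition F2 :: "(real^'n) set \<Rightarrow> (real^'n \<Rightarrow> real \<Rightarrow> real) \<Rightarrow> bool" where
  "F2 \<Omega> f \<longleftrightarrow> (\<exists>C>0. \<forall>x\<in>\<Omega>. \<forall>u1\<in>{0..1}. \<forall>u2\<in>{0..1}.
     \<bar>f x u1 - f x u2\<bar> \<le> C * \<bar>u1 - u2\<bar>)"

definition F3 :: "(real^'n) set \<Rightarrow> (real^'n \<Rightarrow> real \<Rightarrow> real) \<Rightarrow> bool" where
  "F3 \<Omega> f \<longleftrightarrow> (\<forall>x\<in>\<Omega>. \<forall>u1\<in>{0..1}. \<forall>u2\<in>{0..1}. u1 < u2 \<longrightarrow> f x u1 \<le> f x u2)"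

end

theory Submission
  imports Defs
begin

text \<open>For \<open>t > 1\<close> put \<open>w(x) = u(t x) - u(x)\<close>; starshapedness of the superlevel sets amounts to \<open>w \<le> 0\<close>.
  By (F1) and scaling, \<open>-(-\<Delta>)^(\<alpha>/2) w \<ge> f(x, u(t x)) - f(x, u(x))\<close> wherever both \<open>x\<close> and \<open>t x\<close>
  lie in \<open>D0 - closure D1\<close>, which is the case where \<open>w > 0\<close>.

  The operator is nonlocal, so a point where \<open>w\<close> is within \<open>\<epsilon>\<close> of its supremum \<open>M\<close> controls the integral
  of \<open>M - w\<close> over any bounded set, at every scale. Under (F3) with \<open>M > 0\<close>, apply this at the scale
  \<open>|x0|\<close> of a near-maximum point: on average over a ball, \<open>w(x), w(t x), ..., w(t^(k-1) x)\<close> are all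
  close to \<open>M\<close>, but they sum to \<open>u(t^k x) - u(x) \<le> 1\<close>, which is absurd once \<open>k M \<ge> 2\<close>. Neither the
  boundedness of \<open>D0\<close> nor a decay of \<open>u\<close> enters, so (i) and (iii) are one argument.

  For (ii), let \<open>t0\<close> be the largest \<open>t\<close> for which \<open>u(t x) \<ge> u(x)\<close> for some \<open>x\<close> outside \<open>D1\<close> with
  \<open>t x \<in> closure D0\<close>. If \<open>t0 > 1\<close>, then \<open>w \<le> 0\<close> for \<open>t = t0\<close> with \<open>w = 0\<close> at such an \<open>x\<close>, and the same
  estimate with \<open>M = 0\<close>, where (F2) makes the right-hand side \<open>O(\<epsilon>)\<close>, forces \<open>w = 0\<close> everywhere.\<close>

section \<open>Affine changes of variables and the Levy kernel\<close>

lemma integral_lborel_affine: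
  fixes f :: "'a::euclidean_space \<Rightarrow> real"
  assumes [measurable]: "f \<in> borel_measurable borel" and c: "c \<noteq> 0"
  shows "(LINT x|lborel. f x) = \<bar>c\<bar> ^ DIM('a) * (LINT x|lborel. f (a + c *\<^sub>R x))"
  by (subst lborel_affine[OF c, of a]) (simp add: integral_density integral_distr)

lemma integrable_lborel_affine:
  fixes f :: "'a::euclidean_space \<Rightarrow> real"
  assumes f: "integrable lborel f" and c: "c \<noteq> 0"
  shows "integrable lborel (\<lambda>x. f (a + c *\<^sub>R x))"
proof -
  have [measurable]: "f \<in> borel_measurable borel" using f by auto
  have "integrable (density (distr lborel borel (\<lambda>x. a + c *\<^sub>R x)) (\<lambda>_. \<bar>c\<bar> ^ DIM('a))) f"
    using f lborel_affine[OF c, of a] by simp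
  then have "integrable lborel (\<lambda>x. \<bar>c\<bar> ^ DIM('a) * f (a + c *\<^sub>R x))"
    by (simp add: integrable_density integrable_distr_eq)
  then show ?thesis using c by simp
qed

lemma integral_lborel_translate:
  fixes f :: "'a::euclidean_space \<Rightarrow> real"
  assumes "f \<in> borel_measurable borel"
  shows "(LINT x|lborel. f (a + x)) = (LINT x|lborel. f x)"
  using integral_lborel_affine[OF assms, of 1 a] by simp

lemma integral_lborel_reflect:
  fixes f :: "'a::euclidean_space \<Rightarrow> real"
  assumes "f \<in> borel_measurable borel"
  shows "(LINT x|lborel. f (a - x)) = (LINT x|lborel. f x)"
  using integral_lborel_affine[OF assms, of "-1" a] by simp

text \<open>The kernel of the operator without its constant. At \<open>h = 0\<close> division by
  zero gives the value 0, so positive lower bounds hold only off the origin.\<close>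

definition levy_kernel :: "real \<Rightarrow> real^'n \<Rightarrow> real" where
  "levy_kernel \<alpha> h = 1 / norm h powr (real CARD('n) + \<alpha>)"

lemma levy_kernel_measurable [measurable]: "levy_kernel \<alpha> \<in> borel_measurable borel"
  unfolding levy_kernel_def by measurable

lemma levy_kernel_nonneg [simp]: "0 \<le> levy_kernel \<alpha> h"
  by (simp add: levy_kernel_def)

lemma levy_kernel_minus [simp]: "levy_kernel \<alpha> (- h) = levy_kernel \<alpha> h"
  by (simp add: levy_kernel_def)

lemma levy_kernel_scaleR:
  fixes h :: "real^'n"
  assumes "0 < t"
  shows "levy_kernel \<alpha> (t *\<^sub>R h) = t powr - (real CARD('n) + \<alpha>) * levy_kernel \<alpha> h"
  unfolding levy_kernel_def powr_minus using assms by (simp add: powr_mult field_simps)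

lemma levy_kernel_lower_bound:
  fixes h :: "real^'n"
  assumes "norm h \<le> L" "h \<noteq> 0" "0 < \<alpha>"
  shows "L powr - (real CARD('n) + \<alpha>) \<le> levy_kernel \<alpha> h"
proof -
  have "norm h powr (real CARD('n) + \<alpha>) \<le> L powr (real CARD('n) + \<alpha>)"
    using assms by (intro powr_mono2) auto
  moreover have "0 < L" using assms by (metis order.strict_trans2 zero_less_norm_iff)
  ultimately show ?thesis using assms
    unfolding levy_kernel_def powr_minus by (simp add: divide_simps)
qed

lemma power_powr_eq:
  fixes x :: real
  assumes "0 < x"
  shows "(x ^ n) powr s = (x powr s) ^ n"
  using assms by (induction n) (simp_all add: powr_mult)

text \<open>A dyadic decomposition in place of polar coordinates. The pieces near the origin form a
  geometric series of ratio 2^(\<alpha>-2), the far pieces one of ratio 2^(-\<alpha>); the two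
  bounds on \<alpha> make them converge.\<close>

lemma levy_kernel_integrable:
  assumes "0 < \<alpha>" "\<alpha> < 2"
  shows "integrable lborel (\<lambda>h::real^'n. min 1 ((norm h)\<^sup>2) * levy_kernel \<alpha> h)"
proof -
  let ?N = "CARD('n)"
  define s where "s = real ?N + \<alpha>"
  let ?g = "\<lambda>h::real^'n. min 1 ((norm h)\<^sup>2) * levy_kernel \<alpha> h"
  \<comment> \<open>\<open>a k\<close> bounds the integrand on 2^-(k+1) < |h| <= 2^-k, and
    \<open>b k\<close> on 2^k <= |h| <= 2^(k+1). Full balls replace the annuli because their volume
    is explicit; this costs only constant factors.\<close>
  define a where "a k = (1/4) ^ k * (2 powr s) ^ Suc k" for k :: nat
  define b where "b k = (2 powr - s) ^ k" for k :: nat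
  let ?A = "\<lambda>k::nat. cball (0::real^'n) ((1/2) ^ k)"
  let ?B = "\<lambda>k::nat. cball (0::real^'n) (2 ^ Suc k)"
  let ?F = "\<lambda>k h. ennreal (a k) * indicator (?A k) h + ennreal (b k) * indicator (?B k) h"
  have anb: "0 \<le> a k" "0 \<le> b k" for k by (auto simp: a_def b_def)
  have s: "0 < s" using assms by (simp add: s_def add_pos_pos)
  have le: "ennreal (?g h) \<le> (\<Sum>k. ?F k h)" for h
  proof -
    consider "h = 0" | "h \<noteq> 0" "norm h \<le> 1" | "1 < norm h" by linarith
    then show ?thesis
    proof cases
      case 1 then show ?thesis by (simp add: levy_kernel_def)
    next
      case 2
      have ex: "\<exists>k. (1/2) ^ k < norm h" using 2 real_arch_pow_inv[of "norm h" "1/2"] by auto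
      define k where "k = (LEAST k. (1/2) ^ k < norm h)"
      have k: "(1/2) ^ k < norm h" unfolding k_def by (rule LeastI_ex[OF ex])
      have kmin: "norm h \<le> (1/2) ^ j" if "j < k" for j
        using not_less_Least[OF that[unfolded k_def]] by simp
      have "k \<noteq> 0" using k 2 by (cases k) auto
      then obtain j where kj: "k = Suc j" using not0_implies_Suc by blast
      have j: "norm h \<le> (1/2) ^ j" "(1/2) ^ Suc j < norm h" using k kmin kj by auto
      have "((1/2) ^ Suc j) powr s \<le> norm h powr s" using j s by (intro powr_mono2) auto
      then have "levy_kernel \<alpha> h \<le> 1 / ((1/2) ^ Suc j) powr s"
        using 2 by (auto simp: levy_kernel_def s_def intro!: divide_left_mono)
      also have "\<dots> = (2 powr s) ^ Suc j"
        using power_powr_eq[of "1/2" "Suc j" s] by (simp add: powr_divide power_one_over field_simps)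
      finally have 1: "levy_kernel \<alpha> h \<le> (2 powr s) ^ Suc j" .
      have "(norm h)\<^sup>2 \<le> ((1/2) ^ j)\<^sup>2" using j by (intro power_mono) auto
      also have "\<dots> = (1/4) ^ j" by (simp add: power2_eq_square flip: power_mult_distrib)
      finally have "min 1 ((norm h)\<^sup>2) \<le> (1/4) ^ j" by simp
      then have "?g h \<le> a j" unfolding a_def using 1 by (intro mult_mono) auto
      then have "ennreal (?g h) \<le> ennreal (a j)" by (rule ennreal_leI)
      also have "\<dots> \<le> ?F j h" using j by (simp add: add_increasing add_increasing2)
      also have "\<dots> \<le> (\<Sum>k. ?F k h)"
        by (rule order.trans[OF _ sum_le_suminf[where I="{j}"]]) auto
      finally show ?thesis .
    next
      case 3
      have ex: "\<exists>k. norm h < 2 ^ k" using real_arch_pow[of 2 "norm h"] by auto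
      define k where "k = (LEAST k. norm h < 2 ^ k)"
      have k: "norm h < 2 ^ k" unfolding k_def by (rule LeastI_ex[OF ex])
      have kmin: "2 ^ j \<le> norm h" if "j < k" for j
        using not_less_Least[OF that[unfolded k_def]] by simp
      have "k \<noteq> 0" using k 3 by (cases k) auto
      then obtain j where kj: "k = Suc j" using not0_implies_Suc by blast
      have j: "norm h \<le> 2 ^ Suc j" "2 ^ j \<le> norm h" using k kmin kj by auto
      have "(2 ^ j) powr s \<le> norm h powr s" using j s by (intro powr_mono2) auto
      then have "levy_kernel \<alpha> h \<le> 1 / (2 ^ j) powr s"
        using 3 by (auto simp: levy_kernel_def s_def intro!: divide_left_mono mult_pos_pos)
      also have "\<dots> = b j"
        using power_powr_eq[of 2 j s] by (simp add: b_def powr_minus power_inverse field_simps)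
      finally have 1: "levy_kernel \<alpha> h \<le> b j" .
      have "?g h \<le> 1 * levy_kernel \<alpha> h" by (intro mult_right_mono) auto
      then have "?g h \<le> b j" using 1 by simp
      then have "ennreal (?g h) \<le> ennreal (b j)" by (rule ennreal_leI)
      also have "\<dots> \<le> ?F j h" using j by (simp add: add_increasing add_increasing2)
      also have "\<dots> \<le> (\<Sum>k. ?F k h)"
        by (rule order.trans[OF _ sum_le_suminf[where I="{j}"]]) auto
      finally show ?thesis .
    qed
  qed
  let ?\<omega> = "unit_ball_vol (real ?N)"
  have "(\<integral>\<^sup>+h. ennreal (?g h) \<partial>lborel) \<le> (\<integral>\<^sup>+h. (\<Sum>k. ?F k h) \<partial>lborel)"
    by (intro nn_integral_mono le)
  also have "\<dots> = (\<Sum>k. \<integral>\<^sup>+h. ?F k h \<partial>lborel)"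
    by (rule nn_integral_suminf) (intro borel_measurable_add borel_measurable_times_ennreal borel_measurable_const borel_measurable_indicator; simp)
  also have "\<dots> = (\<Sum>k. ennreal (a k * (?\<omega> * ((1/2) ^ k) ^ ?N) + b k * (?\<omega> * (2 ^ Suc k) ^ ?N)))"
  proof (intro suminf_cong)
    fix k
    have [measurable]: "?A k \<in> sets lborel" "?B k \<in> sets lborel" by simp_all
    have "(\<integral>\<^sup>+h. ?F k h \<partial>lborel)
        = (\<integral>\<^sup>+h. ennreal (a k) * indicator (?A k) h \<partial>lborel)
        + (\<integral>\<^sup>+h. ennreal (b k) * indicator (?B k) h \<partial>lborel)"
      by (rule nn_integral_add) measurable
    also have "\<dots> = ennreal (a k) * emeasure lborel (?A k) + ennreal (b k) * emeasure lborel (?B k)"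
      by (simp only: nn_integral_cmult_indicator \<open>?A k \<in> sets lborel\<close> \<open>?B k \<in> sets lborel\<close>)
    also have "\<dots> = ennreal (a k * (?\<omega> * ((1/2) ^ k) ^ ?N) + b k * (?\<omega> * (2 ^ Suc k) ^ ?N))"
      by (subst (1 2) emeasure_cball) (simp_all add: anb flip: ennreal_mult ennreal_plus)
    finally show "(\<integral>\<^sup>+h. ?F k h \<partial>lborel)
        = ennreal (a k * (?\<omega> * ((1/2) ^ k) ^ ?N) + b k * (?\<omega> * (2 ^ Suc k) ^ ?N))" .
  qed
  also have "\<dots> = (\<Sum>k. ennreal (?\<omega> * 2 powr s * (2 powr (\<alpha> - 2)) ^ k + ?\<omega> * 2 ^ ?N * (2 powr - \<alpha>) ^ k))"
  proof -
    \<comment> \<open>Since s = N + \<alpha>, the volume of the ball cancels the dimension in the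
      exponent, here and in the second identity.\<close>
    have 1: "(1/4) ^ k * (2 powr s) ^ k * ((1/2) ^ k) ^ ?N = (2 powr (\<alpha> - 2)) ^ k" for k
    proof -
      have "(1/4) * 2 powr s * (1/2) ^ ?N = 2 powr (\<alpha> - 2)"
        by (simp add: s_def powr_add powr_diff powr_realpow field_simps)
      then show ?thesis
        by (metis mult.commute power_mult power_mult_distrib)
    qed
    have 2: "(2 powr - s) ^ k * (2 ^ k) ^ ?N = (2 powr - \<alpha>) ^ k" for k
    proof -
      have "2 powr - s * 2 ^ ?N = 2 powr - \<alpha>"
        by (simp add: s_def powr_add powr_diff powr_realpow field_simps powr_minus)
      then show ?thesis
        by (metis mult.commute power_mult power_mult_distrib)
    qed
    have "a k * (?\<omega> * ((1/2) ^ k) ^ ?N) + b k * (?\<omega> * (2 ^ Suc k) ^ ?N)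
        = ?\<omega> * 2 powr s * ((1/4) ^ k * (2 powr s) ^ k * ((1/2) ^ k) ^ ?N)
         + ?\<omega> * 2 ^ ?N * ((2 powr - s) ^ k * (2 ^ k) ^ ?N)" for k
      by (simp add: a_def b_def power_mult_distrib)
    then show ?thesis unfolding 1 2 by simp
  qed
  also have "\<dots> < \<infinity>"
  proof -
    have "2 powr (\<alpha> - 2) < 1" "2 powr - \<alpha> < 1" using assms powr_less_one[of 2] by auto
    then have "summable (\<lambda>k. ?\<omega> * 2 powr s * (2 powr (\<alpha> - 2)) ^ k + ?\<omega> * 2 ^ ?N * (2 powr - \<alpha>) ^ k)"
      by (intro summable_add summable_mult summable_geometric) auto
    from ennreal_suminf_neq_top[OF this] show ?thesis by (simp add: less_top)
  qed
  finally have "(\<integral>\<^sup>+h. ennreal (?g h) \<partial>lborel) < \<infinity>" .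
  then show ?thesis by (intro integrableI_nonneg) auto
qed

section \<open>A smooth mollifier\<close>

text \<open>For k = 0 this is the standard smooth function that is flat at 0. The powers of s in the
  denominator make the span of the family closed under differentiation.\<close>

definition flat_exp :: "nat \<Rightarrow> real \<Rightarrow> real" where
  "flat_exp k s = (if s \<le> 0 then 0 else exp (- 1 / s) / s ^ k)"

lemma power_le_fact_exp:
  fixes x :: real
  assumes "0 \<le> x"
  shows "x ^ k \<le> fact k * exp x"
proof -
  have "x ^ k / fact k \<le> exp x"
    using sum_le_suminf[OF summable_exp[of x], of "{k}"] assms by (simp add: exp_def field_simps)
  then show ?thesis by (simp add: field_simps)
qed

lemma flat_exp_nonneg [simp]: "0 \<le> flat_exp k s"
  by (simp add: flat_exp_def)

text \<open>For s > 0 and x = 1/s the value is x^k exp(-x), and x^k / k! is a single term of the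
  series of exp(x).\<close>

lemma flat_exp_bounded: "flat_exp k s \<le> fact k"
proof (cases "s \<le> 0")
  case False
  then have "(1 / s) ^ k \<le> fact k * exp (1 / s)" by (intro power_le_fact_exp) auto
  then show ?thesis using False
    by (simp add: flat_exp_def exp_minus field_simps power_one_over)
qed (simp add: flat_exp_def)

lemma flat_exp_Suc: "flat_exp (Suc k) s = flat_exp k s / s"
  by (simp add: flat_exp_def field_simps)

lemma flat_exp_has_derivative:
  "(flat_exp k has_real_derivative flat_exp (k + 2) s - real k * flat_exp (k + 1) s) (at s)"
proof -
  consider "s < 0" | "s > 0" | "s = 0" by linarith
  then show ?thesis
  proof cases
    case 1
    have "((\<lambda>_. 0) has_real_derivative 0) (at s)" by simp
    then have "(flat_exp k has_real_derivative 0) (at s)"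
      by (rule has_field_derivative_transform_within_open[where S="{..<0}"]) (use 1 in \<open>auto simp: flat_exp_def\<close>)
    then show ?thesis using 1 by (simp add: flat_exp_def)
  next
    case 2
    have pw: "m = 0 \<or> s ^ m = s * s ^ (m - Suc 0)" for m by (cases m) auto
    have "((\<lambda>s. exp (- 1 / s) / s ^ k) has_real_derivative
        flat_exp (k + 2) s - real k * flat_exp (k + 1) s) (at s)"
      using 2 pw[of "k - 1"] by (cases k; auto intro!: derivative_eq_intros simp: flat_exp_def field_simps power2_eq_square)
    then show ?thesis
      by (rule has_field_derivative_transform_within_open[where S="{0<..}"]) (use 2 in \<open>auto simp: flat_exp_def\<close>)
  next
    case 3
    \<comment> \<open>The difference quotient of \<open>flat_exp k\<close> at 0 is
      \<open>flat_exp (Suc k)\<close>. It tends to 0 because dividing it once more by h still leaves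
      a bounded function.\<close>
    have b: "\<bar>flat_exp (Suc k) h\<bar> \<le> fact (k + 2) * \<bar>h\<bar>" for h
    proof (cases "h \<le> 0")
      case False
      have "flat_exp (Suc (Suc k)) h \<le> fact (k + 2)" using flat_exp_bounded[of "Suc (Suc k)" h] by simp
      then show ?thesis using False by (subst (asm) flat_exp_Suc) (simp add: field_simps)
    qed (simp add: flat_exp_def mult_nonneg_nonpos)
    have "((\<lambda>h. fact (k + 2) * \<bar>h\<bar>) \<longlongrightarrow> 0) (at (0::real))"
      by (auto intro!: tendsto_eq_intros)
    then have "((\<lambda>h. flat_exp (Suc k) h) \<longlongrightarrow> 0) (at 0)"
      by (rule Lim_null_comparison[rotated]) (use b in simp)
    then have "((\<lambda>h. (flat_exp k (0 + h) - flat_exp k 0) / h) \<longlongrightarrow> 0) (at 0)"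
      by (simp add: flat_exp_Suc) (simp add: flat_exp_def)
    then show ?thesis using 3 by (simp add: DERIV_def flat_exp_def)
  qed
qed

text \<open>An algebra of functions closed under directional derivatives and containing the mollifier, so
  that membership gives smoothness of every order at once.\<close>

inductive bump_algebra :: "real^'n \<Rightarrow> real \<Rightarrow> (real^'n \<Rightarrow> real) \<Rightarrow> bool" for z d where
  const: "bump_algebra z d (\<lambda>_. c)"
| inner: "bump_algebra z d (\<lambda>y. y \<bullet> v)"
| flat: "bump_algebra z d (\<lambda>y. flat_exp k (1 - ((z - y) \<bullet> (z - y)) / d\<^sup>2))"
| add: "bump_algebra z d g \<Longrightarrow> bump_algebra z d h \<Longrightarrow> bump_algebra z d (\<lambda>y. g y + h y)"
| mult: "bump_algebra z d g \<Longrightarrow> bump_algebra z d h \<Longrightarrow> bump_algebra z d (\<lambda>y. g y * h y)"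

lemma bump_algebra_derivative:
  assumes "bump_algebra z d g"
  shows "\<exists>g'. (\<forall>y. (g has_derivative (\<lambda>v. g' v y)) (at y)) \<and> (\<forall>v. bump_algebra z d (g' v))"
  using assms
proof (induction rule: bump_algebra.induct)
  case (const c)
  show ?case by (rule exI[of _ "\<lambda>_ _. 0"]) (auto intro: bump_algebra.const)
next
  case (inner v)
  show ?case
    by (rule exI[of _ "\<lambda>w _. w \<bullet> v"]) (auto intro!: bump_algebra.const derivative_eq_intros)
next
  case (flat k)
  let ?s = "\<lambda>y. 1 - ((z - y) \<bullet> (z - y)) / d\<^sup>2"
  \<comment> \<open>Sums with factors -1 replace differences, so that the term is built from the
    constructors of \<open>bump_algebra\<close> alone.\<close>
  let ?g' = "\<lambda>v y. (flat_exp (k + 2) (?s y) + (- real k) * flat_exp (k + 1) (?s y))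
      * (2 / d\<^sup>2 * (z \<bullet> v + (- 1) * (y \<bullet> v)))"
  have "((\<lambda>y. flat_exp k (?s y)) has_derivative (\<lambda>v. ?g' v y)) (at y)" for y
  proof -
    have s: "(?s has_derivative (\<lambda>v. 2 / d\<^sup>2 * (z \<bullet> v + (- 1) * (y \<bullet> v)))) (at y)"
      unfolding divide_inverse
      by (auto intro!: derivative_eq_intros simp: inner_commute inner_diff_left inner_diff_right algebra_simps)
    have "(flat_exp k has_derivative
        (\<lambda>t. (flat_exp (k + 2) (?s y) - real k * flat_exp (k + 1) (?s y)) * t)) (at (?s y))"
      using flat_exp_has_derivative[of k "?s y"] by (simp add: has_field_derivative_def)
    from has_derivative_compose[OF s this] show ?thesis by simp
  qed
  moreover have "bump_algebra z d (?g' v)" for v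
    by (intro bump_algebra.intros)
  ultimately show ?case by (intro exI[of _ ?g']) auto
next
  case (add g h)
  then obtain g' h' where
    "\<And>y. (g has_derivative (\<lambda>v. g' v y)) (at y)" "\<And>v. bump_algebra z d (g' v)"
    "\<And>y. (h has_derivative (\<lambda>v. h' v y)) (at y)" "\<And>v. bump_algebra z d (h' v)" by blast
  then show ?case
    by (intro exI[of _ "\<lambda>v y. g' v y + h' v y"]) (auto intro: bump_algebra.add has_derivative_add)
next
  case (mult g h)
  then obtain g' h' where
    "\<And>y. (g has_derivative (\<lambda>v. g' v y)) (at y)" "\<And>v. bump_algebra z d (g' v)"
    "\<And>y. (h has_derivative (\<lambda>v. h' v y)) (at y)" "\<And>v. bump_algebra z d (h' v)" by blast
  moreover from this mult.hyps have "bump_algebra z d (\<lambda>y. g y * h' v y + g' v y * h y)" for v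
    by (metis bump_algebra.add bump_algebra.mult)
  ultimately show ?case
    by (intro exI[of _ "\<lambda>v y. g y * h' v y + g' v y * h y"]) (auto intro: has_derivative_mult)
qed

lemma bump_algebra_Ck:
  assumes "bump_algebra z d g"
  shows "Ck k g"
  using assms
proof (induction k arbitrary: g)
  case 0
  then obtain g' where "\<And>y. (g has_derivative (\<lambda>v. g' v y)) (at y)"
    using bump_algebra_derivative by blast
  then show ?case by (auto simp: continuous_on_eq_continuous_at intro: has_derivative_continuous)
next
  case (Suc k)
  then obtain g' where d: "\<And>y. (g has_derivative (\<lambda>v. g' v y)) (at y)" and a: "\<And>v. bump_algebra z d (g' v)"
    using bump_algebra_derivative by blast
  have "frechet_derivative g (at y) = (\<lambda>v. g' v y)" for y
    using frechet_derivative_at[OF d[of y]] by simp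
  then show ?case using d a Suc.IH by (auto simp: differentiable_def)
qed

lemma lipschitz_of_deriv_bound:
  fixes F F' :: "real \<Rightarrow> real"
  assumes "\<And>s. (F has_real_derivative F' s) (at s)" and "\<And>s. \<bar>F' s\<bar> \<le> M"
  shows "\<bar>F s - F t\<bar> \<le> M * \<bar>s - t\<bar>"
  using field_differentiable_bound[of UNIV F F' M s t] assms by (simp add: abs_minus_commute)

text \<open>The mean value theorem on either side of p turns the second difference into q times a
  difference of two values of F', taken at points at most 2|q| apart; the bound on F'' does the
  rest.\<close>

lemma second_difference_bound:
  fixes F F' F'' :: "real \<Rightarrow> real"
  assumes F: "\<And>s. (F has_real_derivative F' s) (at s)"
    and F': "\<And>s. (F' has_real_derivative F'' s) (at s)"
    and M: "\<And>s. \<bar>F'' s\<bar> \<le> M"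
  shows "\<bar>F (p + q) + F (p - q) - 2 * F p\<bar> \<le> 2 * M * q\<^sup>2"
proof -
  have M0: "0 \<le> M" using M[of 0] by linarith
  \<comment> \<open>The sign of r is open, so the intermediate point is located only by its distance
    to p.\<close>
  have "\<exists>\<xi>. \<bar>\<xi> - p\<bar> \<le> \<bar>r\<bar> \<and> F (p + r) - F p = r * F' \<xi>" for r
  proof -
    consider "r = 0" | "r > 0" | "r < 0" by linarith
    then show ?thesis
    proof cases
      case 2
      from MVT2[of p "p + r" F F'] F 2 obtain \<xi> where "p < \<xi>" "\<xi> < p + r" "F (p + r) - F p = r * F' \<xi>" by auto
      then show ?thesis by (intro exI[of _ \<xi>]) auto
    next
      case 3
      from MVT2[of "p + r" p F F'] F 3 obtain \<xi> where "p + r < \<xi>" "\<xi> < p" "F p - F (p + r) = - r * F' \<xi>" by auto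
      then show ?thesis by (intro exI[of _ \<xi>]) auto
    qed auto
  qed
  from this[of q] this[of "- q"] obtain \<xi> \<eta> where
    \<xi>: "\<bar>\<xi> - p\<bar> \<le> \<bar>q\<bar>" "F (p + q) - F p = q * F' \<xi>" and
    \<eta>: "\<bar>\<eta> - p\<bar> \<le> \<bar>q\<bar>" "F (p - q) - F p = - q * F' \<eta>" by auto
  have "F (p + q) + F (p - q) - 2 * F p = q * (F' \<xi> - F' \<eta>)"
    using \<xi> \<eta> by (simp add: algebra_simps)
  then have "\<bar>F (p + q) + F (p - q) - 2 * F p\<bar> = \<bar>q\<bar> * \<bar>F' \<xi> - F' \<eta>\<bar>" by (simp add: abs_mult)
  also have "\<dots> \<le> \<bar>q\<bar> * (M * \<bar>\<xi> - \<eta>\<bar>)"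
    by (intro mult_left_mono lipschitz_of_deriv_bound[OF F' M]) auto
  also have "\<dots> \<le> \<bar>q\<bar> * (M * (2 * \<bar>q\<bar>))"
    using \<xi> \<eta> M0 by (intro mult_left_mono) auto
  also have "\<dots> = 2 * M * \<bar>q\<bar>\<^sup>2" by (simp only: power2_eq_square mult_ac)
  finally show ?thesis by simp
qed

text \<open>The classical bump exp(-1 / (1 - |x|^2 / d^2)) on |x| < d, extended by 0. It is smooth
  across the sphere because \<open>flat_exp 0\<close> is flat at 0.\<close>

definition bump_profile :: "real \<Rightarrow> real^'n \<Rightarrow> real" where
  "bump_profile d x = flat_exp 0 (1 - (x \<bullet> x) / d\<^sup>2)"

definition bump :: "real \<Rightarrow> real^'n \<Rightarrow> real" where
  "bump d x = bump_profile d x / (LINT y|lborel. bump_profile d (y::real^'n))"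

lemma bump_profile_bounds: "0 \<le> bump_profile d x" "bump_profile d x \<le> 1"
  using flat_exp_bounded[of 0] by (auto simp: bump_profile_def)

lemma continuous_bump_profile: "continuous_on UNIV (bump_profile d :: real^'n \<Rightarrow> real)"
proof -
  have "continuous_on UNIV (flat_exp 0)"
    using flat_exp_has_derivative by (auto simp: continuous_on_eq_continuous_at intro: DERIV_isCont)
  then show ?thesis unfolding bump_profile_def
    by (rule continuous_on_compose2[of UNIV "flat_exp 0"]) (auto simp: divide_inverse intro!: continuous_intros)
qed

lemma bump_profile_measurable [measurable]: "bump_profile d \<in> borel_measurable borel"
  by (rule borel_measurable_continuous_onI[OF continuous_bump_profile])

lemma bump_profile_eq_0:
  assumes "0 < d" "d \<le> norm x"
  shows "bump_profile d x = 0"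
proof -
  have "d\<^sup>2 \<le> x \<bullet> x" using assms by (simp add: dot_square_norm power_mono)
  then show ?thesis using assms by (simp add: bump_profile_def flat_exp_def field_simps)
qed

lemma integrable_bounded_support:
  fixes g :: "'a::euclidean_space \<Rightarrow> real"
  assumes [measurable]: "g \<in> borel_measurable borel"
    and b: "\<And>x. \<bar>g x\<bar> \<le> B" and s: "\<And>x. x \<notin> cball a r \<Longrightarrow> g x = 0"
  shows "integrable lborel g"
proof (rule Bochner_Integration.integrable_bound)
  show "integrable lborel (\<lambda>x. B * indicator (cball a r) x :: real)"
    using emeasure_lborel_cball_finite[of a r] by (intro integrable_mult_right integrable_real_indicator) auto
  have "0 \<le> B" using b[of a] by linarith
  then show "AE x in lborel. norm (g x) \<le> norm (B * indicator (cball a r) x :: real)"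
    using b s by (auto simp: indicator_def)
qed auto

lemma integrable_bump_profile: "0 < d \<Longrightarrow> integrable lborel (bump_profile d)"
  by (rule integrable_bounded_support[where a=0 and r=d and B=1])
     (auto simp: bump_profile_bounds bump_profile_eq_0)

text \<open>On the ball of radius d/2 the argument of \<open>flat_exp 0\<close> is at least 3/4, and
  \<open>flat_exp 0\<close> is increasing there. This makes the normalisation in \<open>bump\<close>
  meaningful.\<close>

lemma integral_bump_profile_pos:
  assumes "0 < d"
  shows "0 < (LINT y|lborel. bump_profile d (y::real^'n))"
proof -
  let ?C = "cball (0::real^'n) (d / 2)"
  have C: "integrable lborel (\<lambda>y. flat_exp 0 (3/4) * indicator ?C y)"
    using emeasure_lborel_cball_finite[of "0::real^'n" "d / 2"]
    by (intro integrable_mult_right integrable_real_indicator) auto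
  have "0 < flat_exp 0 (3/4) * measure lborel ?C"
    using content_cball_pos[of "d/2" "0::real^'n"] assms by (intro mult_pos_pos) (auto simp: flat_exp_def)
  also have "\<dots> = (LINT y|lborel. flat_exp 0 (3/4) * indicator ?C y)" by simp
  also have "\<dots> \<le> (LINT y|lborel. bump_profile d (y::real^'n))"
  proof (rule integral_mono[OF C integrable_bump_profile[OF assms]])
    fix y :: "real^'n"
    show "flat_exp 0 (3/4) * indicator ?C y \<le> bump_profile d y"
    proof (cases "y \<in> ?C")
      case True
      then have "y \<bullet> y \<le> (d/2)\<^sup>2" by (simp add: dot_square_norm power_mono)
      then have "3/4 \<le> 1 - (y \<bullet> y) / d\<^sup>2" using assms by (simp add: field_simps power2_eq_square)
      moreover have "flat_exp 0 (3/4) \<le> flat_exp 0 t" if "3/4 \<le> t" for t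
        using that by (simp add: flat_exp_def field_simps)
      ultimately show ?thesis using True by (simp add: bump_profile_def)
    qed (simp add: bump_profile_bounds)
  qed
  finally show ?thesis .
qed

lemma bump_nonneg [simp]: "0 < d \<Longrightarrow> 0 \<le> bump d x"
  by (simp add: bump_def bump_profile_bounds less_imp_le[OF integral_bump_profile_pos])

lemma bump_bounded:
  assumes "0 < d"
  shows "\<exists>M. \<forall>x::real^'n. \<bar>bump d x\<bar> \<le> M"
proof -
  have "\<bar>bump d x\<bar> \<le> 1 / (LINT y|lborel. bump_profile d (y::real^'n))" for x :: "real^'n"
    using bump_profile_bounds[of d x] integral_bump_profile_pos[OF assms, where 'n='n]
    by (auto simp: bump_def intro!: divide_right_mono)
  then show ?thesis by blast
qed

lemma bump_measurable [measurable]: "bump d \<in> borel_measurable borel"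
  unfolding bump_def by measurable

lemma bump_eq_0: "0 < d \<Longrightarrow> d \<le> norm x \<Longrightarrow> bump d x = 0"
  by (simp add: bump_def bump_profile_eq_0)

lemma integrable_bump: "0 < d \<Longrightarrow> integrable lborel (bump d)"
  unfolding bump_def by (intro integrable_divide_zero impI integrable_bump_profile)

lemma integral_bump:
  assumes "0 < d"
  shows "(LINT y|lborel. bump d (y::real^'n)) = 1"
  using integral_bump_profile_pos[OF assms, where 'n='n] by (simp add: bump_def)

text \<open>The profile is invariant under a joint scaling of point and radius, while its integral
  picks up the Jacobian. This moves a dilation from a function to its mollifier.\<close>

lemma bump_rescale:
  assumes "0 < t" "0 < d"
  shows "bump (t * d) (t *\<^sub>R x) = bump d (x::real^'n) / t ^ CARD('n)"
proof -
  have p: "bump_profile (t * d) (t *\<^sub>R x) = bump_profile d x" for x :: "real^'n"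
    using assms by (simp add: bump_profile_def power2_eq_square)
  have "(LINT y|lborel. bump_profile (t * d) (y::real^'n))
      = t ^ CARD('n) * (LINT y|lborel. bump_profile d (y::real^'n))"
    using integral_lborel_affine[of "bump_profile (t * d) :: real^'n \<Rightarrow> real" t 0] assms by (simp add: p)
  then show ?thesis by (simp add: bump_def p)
qed

text \<open>Through these test functions the distributional equation becomes a pointwise statement
  about mollified functions.\<close>

lemma test_function_bump:
  fixes z :: "real^'n" and d :: real
  assumes "0 < d" "cball z d \<subseteq> \<Omega>"
  shows "test_function \<Omega> (\<lambda>y. bump d (z - y))"
proof -
  define I where "I = (LINT y|lborel. bump_profile d (y::real^'n))"
  have "bump_algebra z d (\<lambda>y. (1 / I) * flat_exp 0 (1 - ((z - y) \<bullet> (z - y)) / d\<^sup>2))"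
    by (intro bump_algebra.intros)
  then have "bump_algebra z d (\<lambda>y. bump d (z - y))"
    by (simp add: bump_def bump_profile_def I_def)
  then have "\<forall>k. Ck k (\<lambda>y. bump d (z - y))" using bump_algebra_Ck by blast
  moreover have "{x. bump d (z - x) \<noteq> 0} \<subseteq> cball z d"
    using bump_eq_0[OF assms(1)] by (force simp: dist_norm)
  then have "closure {x. bump d (z - x) \<noteq> 0} \<subseteq> cball z d"
    by (simp add: closure_minimal)
  ultimately show ?thesis using assms(2) unfolding test_function_def
    by (meson bounded_cball bounded_subset closed_closure compact_eq_bounded_closed subset_trans)
qed

text \<open>The mollifier is a function F of |x|^2 with F' and F'' bounded, but the increment of
  |x|^2 grows with |x|. Hence three cases: |h| >= 1, where boundedness suffices; |x| >= d + 1, where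
  all terms vanish; and bounded x with small h, where Taylor's argument applies.\<close>

lemma bump_second_difference:
  assumes d: "0 < d"
  shows "\<exists>K\<ge>0. \<forall>x h::real^'n. \<bar>2 * bump d x - bump d (x + h) - bump d (x - h)\<bar> \<le> K * min 1 ((norm h)\<^sup>2)"
proof -
  define I where "I = (LINT y|lborel. bump_profile d (y::real^'n))"
  have I: "0 < I" unfolding I_def by (rule integral_bump_profile_pos[OF d])
  define F where "F s = flat_exp 0 (1 - s / d\<^sup>2)" for s
  define F' where "F' s = - flat_exp 2 (1 - s / d\<^sup>2) / d\<^sup>2" for s
  define F'' where "F'' s = (flat_exp 4 (1 - s / d\<^sup>2) - 2 * flat_exp 3 (1 - s / d\<^sup>2)) / d\<^sup>2 / d\<^sup>2" for s
  have lin: "((\<lambda>s. 1 - s / d\<^sup>2) has_real_derivative - 1 / d\<^sup>2) (at s)" for s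
    using d by (auto intro!: derivative_eq_intros simp: power2_eq_square)
  have dF: "(F has_real_derivative F' s) (at s)" for s
    unfolding F_def F'_def using DERIV_chain2[OF flat_exp_has_derivative[of 0] lin] by (simp add: numeral_2_eq_2)
  have dF': "(F' has_real_derivative F'' s) (at s)" for s
  proof -
    have "((\<lambda>s. flat_exp 2 (1 - s / d\<^sup>2)) has_real_derivative
        (flat_exp 4 (1 - s / d\<^sup>2) - 2 * flat_exp 3 (1 - s / d\<^sup>2)) * (- 1 / d\<^sup>2)) (at s)"
      using DERIV_chain2[OF flat_exp_has_derivative[of 2] lin] by simp
    from DERIV_cdivide[OF DERIV_minus[OF this], of "d\<^sup>2"] show ?thesis unfolding F'_def F''_def by simp
  qed
  \<comment> \<open>The numerators are 2! for F', and 4! + 2 * 3! for F'', from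
    \<open>flat_exp_bounded\<close>.\<close>
  define M1 where "M1 = 2 / d\<^sup>2"
  define M2 where "M2 = 36 / d\<^sup>2 / d\<^sup>2"
  have M1: "\<bar>F' s\<bar> \<le> M1" for s
    unfolding F'_def M1_def using flat_exp_bounded[of 2 "1 - s / d\<^sup>2"]
    by (auto intro!: divide_right_mono)
  have M2: "\<bar>F'' s\<bar> \<le> M2" for s
  proof -
    let ?t = "1 - s / d\<^sup>2"
    have "flat_exp 4 ?t \<le> 24" "flat_exp 3 ?t \<le> 6"
      using flat_exp_bounded[of 4 ?t] flat_exp_bounded[of 3 ?t] by (simp_all add: fact_numeral)
    then have "\<bar>flat_exp 4 ?t - 2 * flat_exp 3 ?t\<bar> \<le> 36"
      using flat_exp_nonneg[of 4 ?t] flat_exp_nonneg[of 3 ?t] by linarith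
    then show ?thesis unfolding F''_def M2_def by (auto intro!: divide_right_mono)
  qed
  have M0: "\<bar>F s\<bar> \<le> 1" for s using flat_exp_bounded[of 0 "1 - s / d\<^sup>2"] by (simp add: F_def)
  have F0: "F s = 0" if "d\<^sup>2 \<le> s" for s using that d by (simp add: F_def flat_exp_def field_simps)
  \<comment> \<open>The summands serve respectively large h, the second difference of F, and the
    shift of its centre by |h|^2.\<close>
  define K where "K = 4 + 8 * M2 * (d + 1)\<^sup>2 + 2 * M1"
  have M12: "0 \<le> M1" "0 \<le> M2" by (auto simp: M1_def M2_def)
  have bd: "\<bar>2 * F (x \<bullet> x) - F ((x + h) \<bullet> (x + h)) - F ((x - h) \<bullet> (x - h))\<bar> \<le> K * min 1 ((norm h)\<^sup>2)"
    for x h :: "real^'n"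
  proof -
    consider "1 \<le> norm h" | "norm h < 1" "d + 1 \<le> norm x" | "norm h < 1" "norm x < d + 1" by linarith
    then show ?thesis
    proof cases
      case 1
      then have "min 1 ((norm h)\<^sup>2) = 1" by (simp add: one_le_power)
      moreover have "4 \<le> K" using M12 by (simp add: K_def)
      ultimately show ?thesis using M0[of "x \<bullet> x"] M0[of "(x + h) \<bullet> (x + h)"] M0[of "(x - h) \<bullet> (x - h)"] by linarith
    next
      case 2
      have "d \<le> norm (x + h)" using 2 norm_triangle_ineq2[of x "- h"] by simp
      moreover have "d \<le> norm (x - h)" using 2 norm_triangle_ineq2[of x h] by simp
      moreover have "d \<le> norm x" using 2 by simp
      ultimately have "F (x \<bullet> x) = 0" "F ((x + h) \<bullet> (x + h)) = 0" "F ((x - h) \<bullet> (x - h)) = 0"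
        using d by (auto intro!: F0 power_mono simp: dot_square_norm)
      then show ?thesis using M12 by (simp add: K_def)
    next
      case 3
      \<comment> \<open>Centring at |x|^2 + |h|^2 instead of |x|^2 makes the two outer arguments
        symmetric, namely p + q and p - q.\<close>
      define p where "p = x \<bullet> x + h \<bullet> h"
      define q where "q = 2 * (x \<bullet> h)"
      have e: "(x + h) \<bullet> (x + h) = p + q" "(x - h) \<bullet> (x - h) = p - q"
        by (simp_all add: p_def q_def inner_add_left inner_add_right inner_diff_left inner_diff_right inner_commute)
      have "\<bar>x \<bullet> h\<bar> \<le> norm x * norm h" by (rule Cauchy_Schwarz_ineq2)
      also have "\<dots> \<le> (d + 1) * norm h" using 3 by (intro mult_right_mono) auto
      finally have "\<bar>q\<bar> \<le> 2 * ((d + 1) * norm h)" by (simp add: q_def abs_mult)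
      then have "\<bar>q\<bar>\<^sup>2 \<le> (2 * ((d + 1) * norm h))\<^sup>2" by (intro power_mono) auto
      then have q: "q\<^sup>2 \<le> 4 * (d + 1)\<^sup>2 * (norm h)\<^sup>2" by (simp add: power_mult_distrib)
      have "\<bar>F (p + q) + F (p - q) - 2 * F p\<bar> \<le> 2 * M2 * q\<^sup>2"
        by (rule second_difference_bound[OF dF dF' M2])
      also have "\<dots> \<le> 2 * M2 * (4 * (d + 1)\<^sup>2 * (norm h)\<^sup>2)"
        using q M12 by (intro mult_left_mono) auto
      finally have 1: "\<bar>F (p + q) + F (p - q) - 2 * F p\<bar> \<le> 8 * M2 * (d + 1)\<^sup>2 * (norm h)\<^sup>2" by simp
      have 2: "\<bar>F p - F (x \<bullet> x)\<bar> \<le> M1 * (norm h)\<^sup>2"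
        using lipschitz_of_deriv_bound[OF dF M1, of p "x \<bullet> x"] by (simp add: p_def dot_square_norm)
      have "\<bar>2 * F (x \<bullet> x) - F (p + q) - F (p - q)\<bar> \<le> (8 * M2 * (d + 1)\<^sup>2 + 2 * M1) * (norm h)\<^sup>2"
        using 1 2 by (simp add: algebra_simps abs_le_iff)
      also have "\<dots> \<le> K * (norm h)\<^sup>2" by (intro mult_right_mono) (auto simp: K_def)
      also have "(norm h)\<^sup>2 = min 1 ((norm h)\<^sup>2)" using 3 power_le_one[of "norm h" 2] by simp
      finally show ?thesis by (simp add: e)
    qed
  qed
  have "\<bar>2 * bump d x - bump d (x + h) - bump d (x - h)\<bar> \<le> (K / I) * min 1 ((norm h)\<^sup>2)" for x h :: "real^'n"
  proof -
    have "2 * bump d x - bump d (x + h) - bump d (x - h)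
        = (2 * F (x \<bullet> x) - F ((x + h) \<bullet> (x + h)) - F ((x - h) \<bullet> (x - h))) / I"
      by (simp add: bump_def bump_profile_def F_def I_def diff_divide_distrib)
    then show ?thesis using bd[of x h] I by (simp add: divide_right_mono)
  qed
  moreover have "0 \<le> K / I" using M12 I by (simp add: K_def)
  ultimately show ?thesis by blast
qed

section \<open>The fractional Laplacian of a mollifier\<close>

lemma c_frac_pos:
  assumes "0 < \<alpha>" "\<alpha> < 2"
  shows "0 < c_frac N \<alpha>"
  unfolding c_frac_def using assms by (intro divide_pos_pos mult_pos_pos Gamma_real_pos) auto

lemma integrable_mult_levy_kernel:
  fixes g :: "real^'n \<Rightarrow> real"
  assumes \<alpha>: "0 < \<alpha>" "\<alpha> < 2" and [measurable]: "g \<in> borel_measurable borel"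
    and g: "\<And>h. \<bar>g h\<bar> \<le> K * min 1 ((norm h)\<^sup>2)"
  shows "integrable lborel (\<lambda>h. g h * levy_kernel \<alpha> h)"
proof (rule Bochner_Integration.integrable_bound)
  show "integrable lborel (\<lambda>h::real^'n. K * (min 1 ((norm h)\<^sup>2) * levy_kernel \<alpha> h))"
    by (intro integrable_mult_right levy_kernel_integrable \<alpha>)
  have "\<bar>g h * levy_kernel \<alpha> h\<bar> \<le> \<bar>K * (min 1 ((norm h)\<^sup>2) * levy_kernel \<alpha> h)\<bar>" for h
  proof -
    have "\<bar>g h\<bar> * levy_kernel \<alpha> h \<le> (K * min 1 ((norm h)\<^sup>2)) * levy_kernel \<alpha> h"
      by (intro mult_right_mono g) auto
    then have "\<bar>g h * levy_kernel \<alpha> h\<bar> \<le> K * (min 1 ((norm h)\<^sup>2) * levy_kernel \<alpha> h)"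
      by (simp add: abs_mult mult.assoc)
    then show ?thesis by (rule order.trans[OF _ abs_ge_self])
  qed
  then show "AE h in lborel. norm (g h * levy_kernel \<alpha> h) \<le> norm (K * (min 1 ((norm h)\<^sup>2) * levy_kernel \<alpha> h))"
    by (intro always_eventually) simp
qed measurable

text \<open>Averaging the truncated integral over the substitutions y = x + h and y = x - h cancels
  the first-order term. The symmetrised integral converges absolutely, so dominated convergence
  removes the truncation. This also shows that the limit behind \<open>Lim\<close> exists.\<close>

lemma frac_laplacian_eq_second_difference:
  fixes \<phi> :: "real^'n \<Rightarrow> real"
  assumes \<alpha>: "0 < \<alpha>" "\<alpha> < 2" and [measurable]: "\<phi> \<in> borel_measurable borel"
    and M: "\<And>y. \<bar>\<phi> y\<bar> \<le> M"
    and K: "\<And>h. \<bar>2 * \<phi> x - \<phi> (x + h) - \<phi> (x - h)\<bar> \<le> K * min 1 ((norm h)\<^sup>2)"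
  shows "frac_laplacian \<alpha> \<phi> x =
    c_frac CARD('n) \<alpha> / 2 * (LINT h|lborel. (2 * \<phi> x - \<phi> (x + h) - \<phi> (x - h)) * levy_kernel \<alpha> h)"
proof -
  let ?D = "\<lambda>h. (2 * \<phi> x - \<phi> (x + h) - \<phi> (x - h)) * levy_kernel \<alpha> h"
  let ?J = "\<lambda>\<epsilon>. LINT y:{y. norm (x - y) > \<epsilon>}|lborel. (\<phi> x - \<phi> y) / norm (x - y) powr (real CARD('n) + \<alpha>)"
  have D: "integrable lborel ?D" by (rule integrable_mult_levy_kernel[OF \<alpha> _ K]) measurable
  have J: "?J \<epsilon> = 1/2 * (LINT h|lborel. indicator {h. \<epsilon> < norm h} h * ?D h)" if \<epsilon>: "0 < \<epsilon>" for \<epsilon>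
  proof -
    define f where "f y = indicator {y. \<epsilon> < norm (x - y)} y * ((\<phi> x - \<phi> y) * levy_kernel \<alpha> (x - y))" for y
    have [measurable]: "f \<in> borel_measurable borel" unfolding f_def by measurable
    have "0 \<le> M" using M[of 0] by linarith
    have int: "integrable lborel (\<lambda>h. f (x + c *\<^sub>R h))" if c: "c = 1 \<or> c = -1" for c
    proof -
      have eq: "f (x + c *\<^sub>R h) = (indicator {h. \<epsilon> < norm h} h * (\<phi> x - \<phi> (x + c *\<^sub>R h))) * levy_kernel \<alpha> h" for h
        using c by (auto simp: f_def indicator_def)
      \<comment> \<open>On |h| > \<epsilon> the weight min(1, |h|^2) is at least min(1,
        \<epsilon>^2), so boundedness of \<phi> alone gives a bound of the required form.\<close>
      have "\<bar>indicator {h. \<epsilon> < norm h} h * (\<phi> x - \<phi> (x + c *\<^sub>R h))\<bar>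
          \<le> 2 * M / min 1 (\<epsilon>\<^sup>2) * min 1 ((norm h)\<^sup>2)" for h
      proof (cases "\<epsilon> < norm h")
        case True
        then have "\<epsilon>\<^sup>2 \<le> (norm h)\<^sup>2" using \<epsilon> by (intro power_mono) auto
        then have "min 1 (\<epsilon>\<^sup>2) \<le> min 1 ((norm h)\<^sup>2)" by (intro min.mono) auto
        then have "1 \<le> min 1 ((norm h)\<^sup>2) / min 1 (\<epsilon>\<^sup>2)" using \<epsilon> by simp
        then have "2 * M * 1 \<le> 2 * M * (min 1 ((norm h)\<^sup>2) / min 1 (\<epsilon>\<^sup>2))"
          using \<open>0 \<le> M\<close> by (intro mult_left_mono) auto
        moreover have "\<bar>\<phi> x - \<phi> (x + c *\<^sub>R h)\<bar> \<le> 2 * M" using M[of x] M[of "x + c *\<^sub>R h"] by linarith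
        ultimately show ?thesis using True by simp
      qed (use \<open>0 \<le> M\<close> \<epsilon> in simp)
      then show ?thesis unfolding eq
        by (intro integrable_mult_levy_kernel[OF \<alpha>, of _ "2 * M / min 1 (\<epsilon>\<^sup>2)"]) auto
    qed
    have "?J \<epsilon> = (LINT y|lborel. f y)"
      unfolding set_lebesgue_integral_def f_def levy_kernel_def by (intro Bochner_Integration.integral_cong) auto
    moreover have "(LINT h|lborel. f (x + h)) = (LINT y|lborel. f y)" "(LINT h|lborel. f (x - h)) = (LINT y|lborel. f y)"
      by (rule integral_lborel_translate integral_lborel_reflect; measurable)+
    moreover have "(LINT h|lborel. f (x + h)) + (LINT h|lborel. f (x - h)) = (LINT h|lborel. f (x + h) + f (x - h))"
      using int[of 1] int[of "-1"] by simp
    moreover have "f (x + h) + f (x - h) = indicator {h. \<epsilon> < norm h} h * ?D h" for h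
      by (auto simp: f_def indicator_def algebra_simps)
    ultimately show ?thesis by simp
  qed
  have "((\<lambda>\<epsilon>. LINT h|lborel. indicator {h. \<epsilon> < norm h} h * ?D h) \<longlongrightarrow> (LINT h|lborel. ?D h)) (at_right 0)"
    unfolding tendsto_at_iff_sequentially comp_def
  proof (intro allI impI)
    fix X :: "nat \<Rightarrow> real"
    assume X: "\<forall>i. X i \<in> {0<..} - {0}" "X \<longlonglongrightarrow> 0"
    show "(\<lambda>i. LINT h|lborel. indicator {h. X i < norm h} h * ?D h) \<longlonglongrightarrow> (LINT h|lborel. ?D h)"
    proof (rule integral_dominated_convergence[where w="\<lambda>h. \<bar>?D h\<bar>"])
      show "integrable lborel (\<lambda>h. \<bar>?D h\<bar>)" using D by simp
      show "AE h in lborel. (\<lambda>i. indicator {h. X i < norm h} h * ?D h) \<longlonglongrightarrow> ?D h"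
      proof (intro always_eventually allI)
        fix h
        show "(\<lambda>i. indicator {h. X i < norm h} h * ?D h) \<longlonglongrightarrow> ?D h"
        proof (cases "h = 0")
          case True then show ?thesis by simp
        next
          case False
          have "eventually (\<lambda>i. X i < norm h) sequentially"
            using order_tendstoD(2)[OF X(2), of "norm h"] False by simp
          then have "eventually (\<lambda>i. indicator {h. X i < norm h} h * ?D h = ?D h) sequentially"
            by eventually_elim simp
          then show ?thesis by (rule tendsto_eventually)
        qed
      qed
    qed (use D in \<open>auto simp: indicator_def\<close>)
  qed
  from tendsto_mult_left[OF this, of "1/2"]
  have "(?J \<longlongrightarrow> 1/2 * (LINT h|lborel. ?D h)) (at_right 0)"
    by (rule Lim_transform_eventually) (simp add: eventually_at_filter J)
  then have "Lim (at_right 0) ?J = 1/2 * (LINT h|lborel. ?D h)"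
    by (intro tendsto_Lim) auto
  then show ?thesis by (simp add: frac_laplacian_def)
qed

section \<open>Mollified functions and distributions tested against mollifiers\<close>

definition mollify :: "(real^'n \<Rightarrow> real) \<Rightarrow> real \<Rightarrow> real^'n \<Rightarrow> real" where
  "mollify w d z = (LINT y|lborel. w y * bump d (z - y))"

lemma integrable_mollify:
  fixes w :: "real^'n \<Rightarrow> real"
  assumes [measurable]: "w \<in> borel_measurable borel" and B: "\<And>y. \<bar>w y\<bar> \<le> B" and d: "0 < d"
  shows "integrable lborel (\<lambda>y. w y * bump d (z - y))"
proof (rule Bochner_Integration.integrable_bound)
  show "integrable lborel (\<lambda>y. B * bump d (z - y))"
    using integrable_lborel_affine[OF integrable_bump[OF d], of "-1" z] by simp
  show "AE y in lborel. norm (w y * bump d (z - y)) \<le> norm (B * bump d (z - y))"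
    using B d by (auto simp: abs_mult intro!: mult_right_mono order.trans[OF B])
qed measurable

lemma integral_bump_diff: "0 < d \<Longrightarrow> (LINT y|lborel. bump d (z - y)) = 1"
  using integral_lborel_reflect[of "bump d" z] integral_bump by simp

lemma mollify_le:
  fixes w :: "real^'n \<Rightarrow> real"
  assumes [measurable]: "w \<in> borel_measurable borel" and B: "\<And>y. \<bar>w y\<bar> \<le> B" and d: "0 < d"
    and a: "\<And>y. y \<in> cball z d \<Longrightarrow> w y \<le> a"
  shows "mollify w d z \<le> a"
proof -
  have "mollify w d z \<le> (LINT y|lborel. a * bump d (z - y))"
    unfolding mollify_def
  proof (rule integral_mono)
    show "integrable lborel (\<lambda>y. w y * bump d (z - y))" by (rule integrable_mollify[OF _ B d]) measurable
    show "integrable lborel (\<lambda>y. a * bump d (z - y))"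
      using integrable_lborel_affine[OF integrable_bump[OF d], of "-1" z] by simp
    show "w y * bump d (z - y) \<le> a * bump d (z - y)" for y
    proof (cases "y \<in> cball z d")
      case True then show ?thesis using a d by (intro mult_right_mono) auto
    next
      case False then show ?thesis using d by (simp add: bump_eq_0 dist_norm)
    qed
  qed
  also have "\<dots> = a" using d by (simp add: integral_bump_diff)
  finally show ?thesis .
qed

lemma mollify_minus: "mollify (\<lambda>y. - w y) d z = - mollify w d z"
  by (simp add: mollify_def)

lemma mollify_ge:
  fixes w :: "real^'n \<Rightarrow> real"
  assumes [measurable]: "w \<in> borel_measurable borel" and B: "\<And>y. \<bar>w y\<bar> \<le> B" and d: "0 < d"
    and a: "\<And>y. y \<in> cball z d \<Longrightarrow> a \<le> w y"
  shows "a \<le> mollify w d z"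
  using mollify_le[of "\<lambda>y. - w y" B d z "- a"] B a d by (simp add: mollify_minus)

lemma mollify_altdef:
  fixes w :: "real^'n \<Rightarrow> real"
  assumes [measurable]: "w \<in> borel_measurable borel"
  shows "mollify w d z = (LINT x|lborel. w (z - x) * bump d x)"
  unfolding mollify_def
  using integral_lborel_reflect[of "\<lambda>y. w y * bump d (z - y)" z] by simp

lemma continuous_mollify:
  fixes w :: "real^'n \<Rightarrow> real"
  assumes w: "continuous_on UNIV w" and B: "\<And>y. \<bar>w y\<bar> \<le> B" and d: "0 < d"
  shows "continuous_on UNIV (mollify w d)"
proof -
  have [measurable]: "w \<in> borel_measurable borel" by (rule borel_measurable_continuous_onI[OF w])
  show ?thesis
  proof (rule continuous_at_imp_continuous_on, intro ballI)
    fix z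
    show "isCont (mollify w d) z"
      unfolding continuous_at_sequentially comp_def
    proof (intro allI impI)
      fix X assume X: "X \<longlonglongrightarrow> z"
      \<comment> \<open>With the moving point placed inside w, the weight \<open>bump d x\<close> is
        the same for all i and yields the integrable majorant.\<close>
      have "(\<lambda>i. LINT x|lborel. w (X i - x) * bump d x) \<longlonglongrightarrow> (LINT x|lborel. w (z - x) * bump d x)"
      proof (rule integral_dominated_convergence[where w="\<lambda>x. B * bump d x"])
        show "integrable lborel (\<lambda>x. B * bump d x)" by (intro integrable_mult_right integrable_bump d)
        show "AE x in lborel. (\<lambda>i. w (X i - x) * bump d x) \<longlonglongrightarrow> w (z - x) * bump d x"
        proof (intro always_eventually allI)
          fix x
          have "isCont w (z - x)" using w by (simp add: continuous_on_eq_continuous_at)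
          moreover have "(\<lambda>i. X i - x) \<longlonglongrightarrow> z - x" by (intro tendsto_intros X)
          ultimately have "(\<lambda>i. w (X i - x)) \<longlonglongrightarrow> w (z - x)" by (rule isCont_tendsto_compose)
          then show "(\<lambda>i. w (X i - x) * bump d x) \<longlonglongrightarrow> w (z - x) * bump d x" by (rule tendsto_mult_right)
        qed
        show "AE x in lborel. norm (w (X i - x) * bump d x) \<le> B * bump d x" for i
          using d by (auto simp: abs_mult intro!: mult_right_mono B)
      qed measurable
      then show "(\<lambda>i. mollify w d (X i)) \<longlonglongrightarrow> mollify w d z" by (simp add: mollify_altdef)
    qed
  qed
qed

text \<open>Fubini exchanges the second difference with the convolution: testing the distribution at
  z evaluates the operator on \<open>mollify w d\<close> at z. Integrability is stated alongside
  because linear combinations and comparisons of these integrals rely on it.\<close>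

lemma frac_laplacian_dist_bump:
  fixes w :: "real^'n \<Rightarrow> real" and z :: "real^'n"
  assumes \<alpha>: "0 < \<alpha>" "\<alpha> < 2" and [measurable]: "w \<in> borel_measurable borel"
    and B: "\<And>y. \<bar>w y\<bar> \<le> B" and d: "0 < d"
  defines "D \<equiv> \<lambda>h. (2 * mollify w d z - mollify w d (z + h) - mollify w d (z - h)) * levy_kernel \<alpha> h"
  shows integrable_second_difference_mollify: "integrable lborel D"
    and frac_laplacian_dist_bump_eq: "frac_laplacian_dist \<alpha> w (\<lambda>y. bump d (z - y)) =
      c_frac CARD('n) \<alpha> / 2 * (LINT h|lborel. D h)"
proof -
  let ?b = "bump d :: real^'n \<Rightarrow> real"
  obtain K where K0: "0 \<le> K" and
    K: "\<And>x h. \<bar>2 * ?b x - ?b (x + h) - ?b (x - h)\<bar> \<le> K * min 1 ((norm h)\<^sup>2)"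
    using bump_second_difference[OF d] by blast
  obtain M where M: "\<And>x. \<bar>?b x\<bar> \<le> M" using bump_bounded[OF d] by blast
  have B0: "0 \<le> B" using B[of 0] by linarith
  let ?S = "\<lambda>h y. 2 * ?b (z - y) - ?b (z + h - y) - ?b (z - h - y)"
  let ?P = "\<lambda>h y. w y * ?S h y * levy_kernel \<alpha> h"
  have S: "\<bar>?S h y\<bar> \<le> K * min 1 ((norm h)\<^sup>2)" for h y
  proof -
    have "z - y + h = z + h - y" "z - y - h = z - h - y" by simp_all
    then show ?thesis using K[of "z - y" h] by (simp only:)
  qed
  have fl: "frac_laplacian \<alpha> (\<lambda>y. ?b (z - y)) y = c_frac CARD('n) \<alpha> / 2 * (LINT h|lborel. ?S h y * levy_kernel \<alpha> h)" for y
  proof -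
    \<comment> \<open>Passing from y to z - y swaps h and -h, which a second difference does not
      see.\<close>
    have eq: "2 * ?b (z - y) - ?b (z - (y + h)) - ?b (z - (y - h)) = ?S h y" for h
    proof -
      have "z - (y + h) = z - h - y" "z - (y - h) = z + h - y" by simp_all
      then show ?thesis by (simp only:)
    qed
    have "\<bar>2 * ?b (z - y) - ?b (z - (y + h)) - ?b (z - (y - h))\<bar> \<le> K * min 1 ((norm h)\<^sup>2)" for h
      unfolding eq by (rule S)
    then have "frac_laplacian \<alpha> (\<lambda>y. ?b (z - y)) y = c_frac CARD('n) \<alpha> / 2 *
       (LINT h|lborel. (2 * ?b (z - y) - ?b (z - (y + h)) - ?b (z - (y - h))) * levy_kernel \<alpha> h)"
      by (intro frac_laplacian_eq_second_difference[OF \<alpha> _ M]) auto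
    then show ?thesis by (simp only: eq)
  qed
  let ?g = "\<lambda>h::real^'n. B * K * (min 1 ((norm h)\<^sup>2) * levy_kernel \<alpha> h)"
  let ?V = "unit_ball_vol (real CARD('n)) * d ^ CARD('n)"
  have int: "integrable (lborel \<Otimes>\<^sub>M lborel) (\<lambda>(h, y). ?P h y)"
  proof (rule integrableI_bounded)
    show "(\<lambda>(h, y). ?P h y) \<in> borel_measurable (lborel \<Otimes>\<^sub>M lborel)" by measurable
    \<comment> \<open>For fixed h the integrand lives on three balls of radius d, so integrating in
      y costs a factor \<open>3 * ?V\<close> independent of h, and the Levy integrability in h
      remains.\<close>
    have P: "ennreal (norm (?P h y)) \<le> ennreal (?g h) *
        (indicator (cball z d) y + indicator (cball (z + h) d) y + indicator (cball (z - h) d) y)" for h y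
    proof (cases "y \<in> cball z d \<union> cball (z + h) d \<union> cball (z - h) d")
      case True
      have "\<bar>w y\<bar> * \<bar>?S h y\<bar> * levy_kernel \<alpha> h \<le> B * (K * min 1 ((norm h)\<^sup>2)) * levy_kernel \<alpha> h"
        by (intro mult_mono mult_right_mono B S B0) auto
      then have "norm (?P h y) \<le> ?g h" by (simp add: abs_mult mult_ac)
      then have "ennreal (norm (?P h y)) \<le> ennreal (?g h) * 1" by (simp add: ennreal_leI)
      also have "\<dots> \<le> ennreal (?g h) *
        (indicator (cball z d) y + indicator (cball (z + h) d) y + indicator (cball (z - h) d) y)"
        using True by (intro mult_left_mono) (auto simp: indicator_def)
      finally show ?thesis .
    next
      case False
      then have "?b (z - y) = 0" "?b (z + h - y) = 0" "?b (z - h - y) = 0"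
        using d by (auto intro!: bump_eq_0 simp: dist_norm)
      then show ?thesis by simp
    qed
    have "(\<integral>\<^sup>+p. ennreal (norm (case p of (h, y) \<Rightarrow> ?P h y)) \<partial>(lborel \<Otimes>\<^sub>M lborel))
        = (\<integral>\<^sup>+h. \<integral>\<^sup>+y. ennreal (norm (?P h y)) \<partial>lborel \<partial>lborel)"
      by (subst lborel.nn_integral_fst[symmetric]) auto
    also have "\<dots> \<le> (\<integral>\<^sup>+h. ennreal (?g h) * ennreal (3 * ?V) \<partial>lborel)"
    proof (rule nn_integral_mono)
      fix h :: "real^'n"
      have [measurable]: "cball a d \<in> sets lborel" for a :: "real^'n" by simp
      have "(\<integral>\<^sup>+y. ennreal (norm (?P h y)) \<partial>lborel) \<le> (\<integral>\<^sup>+y. ennreal (?g h) *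
        (indicator (cball z d) y + indicator (cball (z + h) d) y + indicator (cball (z - h) d) y) \<partial>lborel)"
        by (rule nn_integral_mono[OF P])
      also have "\<dots> = ennreal (?g h) * (emeasure lborel (cball z d) + emeasure lborel (cball (z + h) d) + emeasure lborel (cball (z - h) d))"
        by (subst nn_integral_cmult, simp) (simp add: nn_integral_add)
      also have "\<dots> = ennreal (?g h) * ennreal (3 * ?V)"
        using d by (simp add: emeasure_cball flip: ennreal_plus)
      finally show "(\<integral>\<^sup>+y. ennreal (norm (?P h y)) \<partial>lborel) \<le> ennreal (?g h) * ennreal (3 * ?V)" .
    qed
    also have "\<dots> = (\<integral>\<^sup>+h. ennreal (?g h) \<partial>lborel) * ennreal (3 * ?V)"
      by (rule nn_integral_multc) measurable
    also have "\<dots> < \<infinity>"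
    proof -
      have "integrable lborel ?g" by (intro integrable_mult_right levy_kernel_integrable \<alpha>)
      moreover have "0 \<le> ?g h" for h using B0 K0 by simp
      ultimately have "(\<integral>\<^sup>+h. ennreal (?g h) \<partial>lborel) = ennreal (LINT h|lborel. ?g h)"
        by (intro nn_integral_eq_integral) auto
      then show ?thesis by (simp add: ennreal_mult_less_top)
    qed
    finally show "(\<integral>\<^sup>+p. ennreal (norm (case p of (h, y) \<Rightarrow> ?P h y)) \<partial>(lborel \<Otimes>\<^sub>M lborel)) < \<infinity>" .
  qed
  have in1: "(LINT y|lborel. ?P h y) = D h" for h
  proof -
    have i: "integrable lborel (\<lambda>y. w y * ?b (a - y))" for a by (rule integrable_mollify[OF _ B d]) measurable
    have "(LINT y|lborel. ?P h y) = (LINT y|lborel. 2 * (w y * ?b (z - y)) - w y * ?b (z + h - y) - w y * ?b (z - h - y)) * levy_kernel \<alpha> h"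
      unfolding integral_mult_left_zero[symmetric] by (intro Bochner_Integration.integral_cong) (auto simp: algebra_simps)
    also have "\<dots> = D h" unfolding D_def mollify_def using i by simp
    finally show ?thesis .
  qed
  show "integrable lborel D"
    using lborel_pair.integrable_fst[OF int] unfolding in1 .
  have "frac_laplacian_dist \<alpha> w (\<lambda>y. ?b (z - y)) = (LINT y|lborel. c_frac CARD('n) \<alpha> / 2 * (LINT h|lborel. ?P h y))"
    unfolding frac_laplacian_dist_def fl
    by (intro Bochner_Integration.integral_cong) (auto simp: mult_ac simp flip: integral_mult_right_zero)
  also have "\<dots> = c_frac CARD('n) \<alpha> / 2 * (LINT h|lborel. D h)"
    using lborel_pair.Fubini_integral[OF int] unfolding in1 by simp
  finally show "frac_laplacian_dist \<alpha> w (\<lambda>y. ?b (z - y)) = c_frac CARD('n) \<alpha> / 2 * (LINT h|lborel. D h)" .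
qed

lemma mollify_diff:
  fixes w v :: "real^'n \<Rightarrow> real"
  assumes "w \<in> borel_measurable borel" "\<And>y. \<bar>w y\<bar> \<le> B"
    and "v \<in> borel_measurable borel" "\<And>y. \<bar>v y\<bar> \<le> B'" and "0 < d"
  shows "mollify (\<lambda>y. w y - v y) d z = mollify w d z - mollify v d z"
  using integrable_mollify[OF assms(1,2,5), of z] integrable_mollify[OF assms(3,4,5), of z]
  by (simp add: mollify_def left_diff_distrib)

lemma frac_laplacian_dist_bump_diff:
  fixes w v :: "real^'n \<Rightarrow> real"
  assumes \<alpha>: "0 < \<alpha>" "\<alpha> < 2"
    and w: "w \<in> borel_measurable borel" "\<And>y. \<bar>w y\<bar> \<le> B"
    and v: "v \<in> borel_measurable borel" "\<And>y. \<bar>v y\<bar> \<le> B'" and d: "0 < d"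
  shows "frac_laplacian_dist \<alpha> (\<lambda>y. w y - v y) (\<lambda>y. bump d (z - y)) =
    frac_laplacian_dist \<alpha> w (\<lambda>y. bump d (z - y)) - frac_laplacian_dist \<alpha> v (\<lambda>y. bump d (z - y))"
proof -
  have wv: "(\<lambda>y. w y - v y) \<in> borel_measurable borel" using w v by measurable
  have b: "\<bar>w y - v y\<bar> \<le> B + B'" for y using w(2)[of y] v(2)[of y] by linarith
  show ?thesis
    unfolding frac_laplacian_dist_bump_eq[OF \<alpha> wv b d] frac_laplacian_dist_bump_eq[OF \<alpha> w d]
      frac_laplacian_dist_bump_eq[OF \<alpha> v d] mollify_diff[OF w v d]
      right_diff_distrib[symmetric]
      Bochner_Integration.integral_diff[OF integrable_second_difference_mollify[OF \<alpha> w d] integrable_second_difference_mollify[OF \<alpha> v d], symmetric]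
    by (simp add: algebra_simps)
qed

lemma mollify_dilation:
  fixes w :: "real^'n \<Rightarrow> real"
  assumes [measurable]: "w \<in> borel_measurable borel" and t: "0 < t" and d: "0 < d"
  shows "mollify (\<lambda>x. w (t *\<^sub>R x)) d x = mollify w (t * d) (t *\<^sub>R x)"
proof -
  have "mollify w (t * d) (t *\<^sub>R x)
      = t ^ CARD('n) * (LINT y|lborel. w (t *\<^sub>R y) * bump (t * d) (t *\<^sub>R x - t *\<^sub>R y))"
    unfolding mollify_def
    using integral_lborel_affine[of "\<lambda>y. w y * bump (t * d) (t *\<^sub>R x - y)" t 0] t by simp
  also have "\<dots> = mollify (\<lambda>x. w (t *\<^sub>R x)) d x"
    using t by (simp add: mollify_def bump_rescale[OF t d] flip: scaleR_diff_right)
  finally show ?thesis by simp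
qed

text \<open>The Jacobian t^N against the factor t^-(N+\<alpha>) from the kernel leaves t^-\<alpha>;
  solved for the left side, this is the homogeneity of order \<alpha>. The mollifier radius scales
  along with the point.\<close>

lemma frac_laplacian_dist_dilation:
  fixes w :: "real^'n \<Rightarrow> real"
  assumes \<alpha>: "0 < \<alpha>" "\<alpha> < 2" and w[measurable]: "w \<in> borel_measurable borel"
    and B: "\<And>y. \<bar>w y\<bar> \<le> B" and t: "0 < t" and d: "0 < d"
  shows "frac_laplacian_dist \<alpha> (\<lambda>x. w (t *\<^sub>R x)) (\<lambda>y. bump d (z - y)) =
    t powr \<alpha> * frac_laplacian_dist \<alpha> w (\<lambda>y. bump (t * d) (t *\<^sub>R z - y))"
proof -
  let ?D = "\<lambda>h. (2 * mollify w (t * d) (t *\<^sub>R z) - mollify w (t * d) (t *\<^sub>R z + h)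
    - mollify w (t * d) (t *\<^sub>R z - h)) * levy_kernel \<alpha> h"
  have td: "0 < t * d" using t d by simp
  have wt: "(\<lambda>x. w (t *\<^sub>R x)) \<in> borel_measurable borel" by measurable
  have [measurable]: "?D \<in> borel_measurable borel"
    using integrable_second_difference_mollify[OF \<alpha> w B td] by auto
  have "(LINT h|lborel. ?D h) = t ^ CARD('n) * (LINT h|lborel. ?D (t *\<^sub>R h))"
    using integral_lborel_affine[of ?D t 0] t by simp
  also have "(LINT h|lborel. ?D (t *\<^sub>R h)) = (LINT h|lborel. t powr - (real CARD('n) + \<alpha>) *
      ((2 * mollify w (t * d) (t *\<^sub>R z) - mollify w (t * d) (t *\<^sub>R (z + h))
    - mollify w (t * d) (t *\<^sub>R (z - h))) * levy_kernel \<alpha> h))"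
    using t by (intro Bochner_Integration.integral_cong)
      (simp_all add: levy_kernel_scaleR scaleR_add_right scaleR_diff_right)
  also have "t ^ CARD('n) * \<dots> = t powr - \<alpha> * (LINT h|lborel.
      (2 * mollify w (t * d) (t *\<^sub>R z) - mollify w (t * d) (t *\<^sub>R (z + h))
    - mollify w (t * d) (t *\<^sub>R (z - h))) * levy_kernel \<alpha> h)"
    using t by (simp add: powr_diff powr_minus powr_realpow field_simps)
  finally have "t powr \<alpha> * (LINT h|lborel. ?D h) = (LINT h|lborel.
      (2 * mollify w (t * d) (t *\<^sub>R z) - mollify w (t * d) (t *\<^sub>R (z + h))
    - mollify w (t * d) (t *\<^sub>R (z - h))) * levy_kernel \<alpha> h)"
    using t by (simp add: powr_minus field_simps)
  then show ?thesis
    unfolding frac_laplacian_dist_bump_eq[OF \<alpha> wt B d] frac_laplacian_dist_bump_eq[OF \<alpha> w B td]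
      mollify_dilation[OF w t d] by simp
qed

lemma mollify_tendsto:
  fixes w :: "real^'n \<Rightarrow> real"
  assumes w: "continuous_on UNIV w" and B: "\<And>y. \<bar>w y\<bar> \<le> B"
    and X: "X \<longlonglongrightarrow> 0" "\<And>i. 0 < X i"
  shows "(\<lambda>i. mollify w (X i) z) \<longlonglongrightarrow> w z"
proof (rule LIMSEQ_I)
  fix r :: real assume r: "0 < r"
  have wm: "w \<in> borel_measurable borel" by (rule borel_measurable_continuous_onI[OF w])
  have "isCont w z" using w by (simp add: continuous_on_eq_continuous_at)
  then obtain s where s: "0 < s" "\<And>y. dist y z < s \<Longrightarrow> dist (w y) (w z) < r / 2"
    using r unfolding continuous_at_eps_delta by (metis half_gt_zero)
  obtain n where n: "\<And>i. n \<le> i \<Longrightarrow> norm (X i - 0) < s" using LIMSEQ_D[OF X(1) s(1)] by blast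
  show "\<exists>no. \<forall>i\<ge>no. norm (mollify w (X i) z - w z) < r"
  proof (intro exI allI impI)
    fix i assume "n \<le> i"
    then have i: "X i < s" using n[of i] by simp
    have *: "\<bar>w y - w z\<bar> < r / 2" if "y \<in> cball z (X i)" for y
      using s(2)[of y] that i by (auto simp: dist_real_def dist_commute)
    have "w y \<le> w z + r / 2" "w z - r / 2 \<le> w y" if "y \<in> cball z (X i)" for y
      using *[OF that] by linarith+
    then have "mollify w (X i) z \<le> w z + r / 2" "w z - r / 2 \<le> mollify w (X i) z"
      by (intro mollify_le[OF wm B X(2)] mollify_ge[OF wm B X(2)]; blast)+
    then show "norm (mollify w (X i) z - w z) < r" using r unfolding real_norm_def by linarith
  qed
qed

section \<open>Near-maximum points\<close>

text \<open>The penalisation at a near-maximum point. It need not be smooth: only the upper bound on its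
  second differences matters.\<close>

definition cap :: "real^'n \<Rightarrow> real \<Rightarrow> real^'n \<Rightarrow> real" where
  "cap a R y = max 0 (1 - (norm (y - a))\<^sup>2 / R\<^sup>2)"

text \<open>Where the cap is positive it is a paraboloid with second difference 2|h|^2/R^2, and
  truncation at 0 can only raise the neighbouring values. Where it vanishes the left side is
  nonpositive. The bound 2 comes from the values lying in [0,1].\<close>

lemma cap_second_difference:
  assumes "0 < R"
  shows "2 * cap a R z - cap a R (z + h) - cap a R (z - h) \<le> 2 * min 1 ((norm h)\<^sup>2 / R\<^sup>2)"
proof -
  define p where "p = z - a"
  have e: "(norm (z + h - a))\<^sup>2 = p \<bullet> p + h \<bullet> h + 2 * (p \<bullet> h)"
    "(norm (z - h - a))\<^sup>2 = p \<bullet> p + h \<bullet> h - 2 * (p \<bullet> h)" "(norm (z - a))\<^sup>2 = p \<bullet> p"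
    by (simp_all add: p_def power2_norm_eq_inner algebra_simps inner_commute)
  have nn: "0 \<le> (norm h)\<^sup>2 / R\<^sup>2" "0 \<le> p \<bullet> p / R\<^sup>2" by auto
  have "cap a R z \<le> 1" "0 \<le> cap a R (z + h)" "0 \<le> cap a R (z - h)"
    using nn(2) by (auto simp: cap_def e)
  moreover have "2 * cap a R z - cap a R (z + h) - cap a R (z - h) \<le> 2 * ((norm h)\<^sup>2 / R\<^sup>2)"
  proof (cases "cap a R z = 0")
    case True
    then show ?thesis using nn(1) \<open>0 \<le> cap a R (z + h)\<close> \<open>0 \<le> cap a R (z - h)\<close> by linarith
  next
    case False
    then have z: "cap a R z = 1 - p \<bullet> p / R\<^sup>2" by (auto simp: cap_def e)
    have "1 - (p \<bullet> p + h \<bullet> h + 2 * (p \<bullet> h)) / R\<^sup>2 \<le> cap a R (z + h)"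
      "1 - (p \<bullet> p + h \<bullet> h - 2 * (p \<bullet> h)) / R\<^sup>2 \<le> cap a R (z - h)"
      by (simp_all add: cap_def e)
    then show ?thesis unfolding z
      by (simp add: power2_norm_eq_inner add_divide_distrib diff_divide_distrib)
  qed
  ultimately show ?thesis by linarith
qed

lemma integrable_min_levy_kernel:
  assumes \<alpha>: "0 < \<alpha>" "\<alpha> < 2" and R: "0 < R"
  shows "integrable lborel (\<lambda>h::real^'n. min 1 ((norm h)\<^sup>2 / R\<^sup>2) * levy_kernel \<alpha> h)"
proof (rule integrable_mult_levy_kernel[OF \<alpha>])
  show "\<bar>min 1 ((norm h)\<^sup>2 / R\<^sup>2)\<bar> \<le> max 1 (1 / R\<^sup>2) * min 1 ((norm h)\<^sup>2)" for h :: "real^'n"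
  proof (cases "(norm h)\<^sup>2 \<le> 1")
    case True
    have "(norm h)\<^sup>2 / R\<^sup>2 \<le> max 1 (1 / R\<^sup>2) * (norm h)\<^sup>2"
      using mult_right_mono[of "1 / R\<^sup>2" "max 1 (1 / R\<^sup>2)" "(norm h)\<^sup>2"] by simp
    then show ?thesis using True by (simp add: min_def)
  next
    case False
    have "\<bar>min 1 ((norm h)\<^sup>2 / R\<^sup>2)\<bar> \<le> 1" by simp
    also have "1 \<le> max 1 (1 / R\<^sup>2) * min 1 ((norm h)\<^sup>2)" using False by simp
    finally show ?thesis .
  qed
qed measurable

text \<open>Makes the cost of the penalisation explicit in R, so that the powers of R cancel when R
  is chosen as the distance of a near-maximum point from the origin.\<close>

lemma integral_min_levy_kernel_scale:
  assumes \<alpha>: "0 < \<alpha>" "\<alpha> < 2" and R: "0 < R"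
  shows "(LINT h|lborel. min 1 ((norm (h::real^'n))\<^sup>2 / R\<^sup>2) * levy_kernel \<alpha> h) =
    R powr - \<alpha> * (LINT h|lborel. min 1 ((norm (h::real^'n))\<^sup>2) * levy_kernel \<alpha> h)"
proof -
  have "(LINT h|lborel. min 1 ((norm (h::real^'n))\<^sup>2 / R\<^sup>2) * levy_kernel \<alpha> h) =
    R ^ CARD('n) * (LINT h|lborel. min 1 ((norm (R *\<^sub>R h::real^'n))\<^sup>2 / R\<^sup>2) * levy_kernel \<alpha> (R *\<^sub>R h))"
    using integral_lborel_affine[of "\<lambda>h::real^'n. min 1 ((norm h)\<^sup>2 / R\<^sup>2) * levy_kernel \<alpha> h" R 0] R by simp
  also have "(LINT h|lborel. min 1 ((norm (R *\<^sub>R h::real^'n))\<^sup>2 / R\<^sup>2) * levy_kernel \<alpha> (R *\<^sub>R h)) =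
     (LINT h|lborel. R powr - (real CARD('n) + \<alpha>) * (min 1 ((norm (h::real^'n))\<^sup>2) * levy_kernel \<alpha> h))"
    using R by (intro Bochner_Integration.integral_cong) (simp_all add: levy_kernel_scaleR power_mult_distrib)
  finally show ?thesis using R by (simp add: powr_diff powr_minus powr_realpow field_simps)
qed

text \<open>At a maximum point z of the penalised function, the second difference of
  \<open>mollify w d\<close>, corrected by the penalty, is nonnegative and bounds from above the sum
  of the two gaps M - \<open>mollify w d\<close> at z + h and z - h, less 2\<epsilon>. Its integral
  against the kernel is controlled by the equation. Since the kernel is bounded below on |h| < L,
  the gap is controlled in mean over a whole ball.\<close>

lemma near_max_mollified:
  fixes w :: "real^'n \<Rightarrow> real"
  assumes \<alpha>: "0 < \<alpha>" "\<alpha> < 2" and w: "continuous_on UNIV w" and B: "\<And>y. \<bar>w y\<bar> \<le> B" and M: "\<And>y. w y \<le> M"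
    and \<epsilon>: "0 < \<epsilon>" and R: "0 < R" "R < L" and d: "0 < d"
    and z: "dist x0 z \<le> R" "\<And>y. mollify w d y + \<epsilon> * cap x0 R y \<le> mollify w d z + \<epsilon> * cap x0 R z"
      "M \<le> mollify w d z + \<epsilon> * cap x0 R z"
    and sub: "frac_laplacian_dist \<alpha> w (\<lambda>y. bump d (z - y)) \<le> \<kappa>"
    and A: "A \<in> sets borel" "A \<subseteq> ball x0 (L - R)"
  shows "(LINT y:A|lborel. M - mollify w d y) \<le> \<epsilon> * (unit_ball_vol (real CARD('n)) * L ^ CARD('n)) +
    L powr (real CARD('n) + \<alpha>) * (\<kappa> / c_frac CARD('n) \<alpha> + \<epsilon> * (R powr - \<alpha> *
      (LINT h|lborel. min 1 ((norm (h::real^'n))\<^sup>2) * levy_kernel \<alpha> h)))"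
proof -
  let ?m = "mollify w d"
  let ?s = "real CARD('n) + \<alpha>"
  let ?c = "c_frac CARD('n) \<alpha>"
  let ?V = "unit_ball_vol (real CARD('n)) * L ^ CARD('n)"
  define I where "I = (LINT h|lborel. min 1 ((norm (h::real^'n))\<^sup>2 / R\<^sup>2) * levy_kernel \<alpha> h)"
  define D where "D h = (2 * ?m z - ?m (z + h) - ?m (z - h)) * levy_kernel \<alpha> h" for h
  define q where "q y = M - ?m y" for y
  define H where "H h = 2 * ?m z - ?m (z + h) - ?m (z - h) + 2 * \<epsilon> * min 1 ((norm h)\<^sup>2 / R\<^sup>2)" for h
  note [measurable] = A(1)
  have wm: "w \<in> borel_measurable borel" by (rule borel_measurable_continuous_onI[OF w])
  have cm: "continuous_on UNIV ?m" by (rule continuous_mollify[OF w B d])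
  have [measurable]: "?m \<in> borel_measurable borel" by (rule borel_measurable_continuous_onI[OF cm])
  have [measurable]: "q \<in> borel_measurable borel" unfolding q_def by measurable
  have q0: "0 \<le> q y" for y unfolding q_def using mollify_le[OF wm B d, of y M] M by simp
  have qB: "q y \<le> M + B" for y
  proof -
    have "- B \<le> w y" for y using B[of y] by linarith
    then show ?thesis unfolding q_def using mollify_ge[OF wm B d, of y "- B"] by simp
  qed
  have L: "0 < L" using R by linarith
  have c: "0 < ?c" by (rule c_frac_pos[OF \<alpha>])
  \<comment> \<open>Maximality at z, compared with z + h and z - h.\<close>
  have H0: "0 \<le> H h" for h
    using z(2)[of "z + h"] z(2)[of "z - h"] mult_left_mono[OF cap_second_difference[OF R(1), of x0 z h], of \<epsilon>] \<epsilon>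
    unfolding H_def by (simp add: algebra_simps)
  \<comment> \<open>The value of \<open>mollify w d\<close> at z is at least M - \<epsilon>, because
    the penalised maximum is at least M and the cap is at most 1.\<close>
  have H1: "q (z + h) + q (z - h) - 2 * \<epsilon> \<le> H h" for h
  proof -
    have "cap x0 R z \<le> 1" by (simp add: cap_def)
    then have "\<epsilon> * cap x0 R z \<le> \<epsilon>" using \<epsilon> by (simp add: mult_left_le)
    moreover have "0 \<le> 2 * \<epsilon> * min 1 ((norm h)\<^sup>2 / R\<^sup>2)" using \<epsilon> by simp
    ultimately show ?thesis using z(3) unfolding H_def q_def by linarith
  qed
  have Dint: "integrable lborel D"
    unfolding D_def by (rule integrable_second_difference_mollify[OF \<alpha> wm B d])
  have "?c / 2 * (LINT h|lborel. D h) \<le> \<kappa>"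
    using sub unfolding frac_laplacian_dist_bump_eq[OF \<alpha> wm B d] D_def .
  then have D\<kappa>: "(LINT h|lborel. D h) \<le> 2 * \<kappa> / ?c" using c by (simp add: field_simps)
  have Heq: "H h * levy_kernel \<alpha> h = D h + 2 * \<epsilon> * (min 1 ((norm h)\<^sup>2 / R\<^sup>2) * levy_kernel \<alpha> h)" for h
    by (simp add: H_def D_def algebra_simps)
  have Hint: "integrable lborel (\<lambda>h. H h * levy_kernel \<alpha> h)"
    unfolding Heq by (intro Bochner_Integration.integrable_add Dint integrable_mult_right integrable_min_levy_kernel[OF \<alpha> R(1)])
  have "(LINT h|lborel. H h * levy_kernel \<alpha> h) = (LINT h|lborel. D h) + 2 * \<epsilon> * I"
    unfolding Heq I_def using Dint integrable_min_levy_kernel[OF \<alpha> R(1), where 'n='n]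
    by (subst Bochner_Integration.integral_add) auto
  then have HI: "(LINT h|lborel. H h * levy_kernel \<alpha> h) \<le> 2 * \<kappa> / ?c + 2 * \<epsilon> * I" using D\<kappa> by simp
  let ?U = "ball (0::real^'n) L"
  have M0: "0 \<le> M + B" using q0[of 0] qB[of 0] by linarith
  have qi: "integrable lborel (\<lambda>h. indicator ?U h * q (z + c *\<^sub>R h))" for c
    by (rule integrable_bounded_support[where a=0 and r=L and B="M + B"])
       (use q0 qB M0 in \<open>auto simp: indicator_def\<close>)
  have qA: "(LINT y|lborel. indicator A y * q y) \<le> (LINT h|lborel. indicator ?U h * q (z + c *\<^sub>R h))"
    \<comment> \<open>The signs c = 1 and c = -1 treat the two shifted gaps together; the ball of
      radius L about z contains A because z is within R of x0.\<close>
    if "c = 1 \<or> c = -1" for c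
  proof -
    have "(LINT h|lborel. indicator ?U h * q (z + c *\<^sub>R h)) = (LINT h|lborel. indicator (ball z L) (z + c *\<^sub>R h) * q (z + c *\<^sub>R h))"
      using that by (intro Bochner_Integration.integral_cong) (auto simp: indicator_def dist_norm)
    also have "\<dots> = (LINT y|lborel. indicator (ball z L) y * q y)"
    proof -
      have [measurable]: "ball z L \<in> sets borel" by simp
      have "(\<lambda>y. indicator (ball z L) y * q y) \<in> borel_measurable borel" by measurable
      from integral_lborel_affine[OF this, of c z] show ?thesis using that by auto
    qed
    also have "\<dots> \<ge> (LINT y|lborel. indicator A y * q y)"
    proof (rule integral_mono')
      show "integrable lborel (\<lambda>y. indicator (ball z L) y * q y)"
        by (rule integrable_bounded_support[where a=z and r=L and B="M + B"])
           (use q0 qB M0 in \<open>auto simp: indicator_def\<close>)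
      have "A \<subseteq> ball z L"
      proof
        fix y assume "y \<in> A"
        then have "dist x0 y < L - R" using A by auto
        then show "y \<in> ball z L" using z(1) dist_triangle2[of z y x0] by (simp add: dist_commute)
      qed
      then show "indicator A y * q y \<le> indicator (ball z L) y * q y" for y
        using q0[of y] by (auto simp: indicator_def)
      show "0 \<le> indicator (ball z L) y * q y" for y using q0[of y] by simp
    qed
    finally show ?thesis .
  qed
  have Ui: "integrable lborel (\<lambda>h. indicator ?U h * (2 * \<epsilon>))"
    using emeasure_lborel_ball_finite[of "0::real^'n" L] by (intro integrable_mult_left integrable_real_indicator) auto
  \<comment> \<open>On |h| < L the kernel is replaced by its lower bound; outside, the left
    integrand is 0 and the right one nonnegative. The point h = 0, where the kernel takes the
    default value 0, is a null set.\<close>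
  have "L powr - ?s * (LINT h|lborel. indicator ?U h * q (z + 1 *\<^sub>R h) + indicator ?U h * q (z + (-1) *\<^sub>R h) - indicator ?U h * (2 * \<epsilon>))
      \<le> (LINT h|lborel. H h * levy_kernel \<alpha> h)"
    unfolding integral_mult_right_zero[symmetric]
  proof (rule integral_mono_AE)
    show "integrable lborel (\<lambda>h. L powr - ?s * (indicator ?U h * q (z + 1 *\<^sub>R h) + indicator ?U h * q (z + (-1) *\<^sub>R h) - indicator ?U h * (2 * \<epsilon>)))"
      by (intro integrable_mult_right Bochner_Integration.integrable_add Bochner_Integration.integrable_diff qi Ui)
    have "AE h in lborel. h \<noteq> (0::real^'n)" by (rule AE_lborel_singleton)
    then show "AE h in lborel. L powr - ?s * (indicator ?U h * q (z + 1 *\<^sub>R h) + indicator ?U h * q (z + (-1) *\<^sub>R h) - indicator ?U h * (2 * \<epsilon>))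
       \<le> H h * levy_kernel \<alpha> h"
    proof eventually_elim
      case (elim h)
      show ?case
      proof (cases "h \<in> ?U")
        case True
        then have "L powr - ?s \<le> levy_kernel \<alpha> h" using elim \<alpha> by (intro levy_kernel_lower_bound) auto
        then have "L powr - ?s * H h \<le> levy_kernel \<alpha> h * H h" using H0 by (rule mult_right_mono)
        moreover have "L powr - ?s * (q (z + h) + q (z - h) - 2 * \<epsilon>) \<le> L powr - ?s * H h"
          using H1 by (rule mult_left_mono) simp
        ultimately show ?thesis using True by (simp add: mult.commute)
      qed (simp add: H0)
    qed
  qed (rule Hint)
  also have "(LINT h|lborel. indicator ?U h * q (z + 1 *\<^sub>R h) + indicator ?U h * q (z + (-1) *\<^sub>R h) - indicator ?U h * (2 * \<epsilon>))
      = (LINT h|lborel. indicator ?U h * q (z + 1 *\<^sub>R h)) + (LINT h|lborel. indicator ?U h * q (z + (-1) *\<^sub>R h))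
        - (LINT h|lborel. indicator ?U h * (2 * \<epsilon>))"
    by (subst Bochner_Integration.integral_diff Bochner_Integration.integral_add;
        (intro Bochner_Integration.integrable_add qi Ui)?)+ simp
  finally have 1: "L powr - ?s * ((LINT h|lborel. indicator ?U h * q (z + 1 *\<^sub>R h)) + (LINT h|lborel. indicator ?U h * q (z + (-1) *\<^sub>R h))
        - (LINT h|lborel. indicator ?U h * (2 * \<epsilon>))) \<le> 2 * \<kappa> / ?c + 2 * \<epsilon> * I" using HI by linarith
  have U: "(LINT h|lborel. indicator ?U h * (2 * \<epsilon>)) = ?V * (2 * \<epsilon>)"
    using L by (simp add: content_ball)
  have "L powr - ?s * (2 * (LINT y|lborel. indicator A y * q y) - ?V * (2 * \<epsilon>)) \<le> 2 * \<kappa> / ?c + 2 * \<epsilon> * I"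
    by (rule order.trans[OF mult_left_mono 1]) (use qA[of 1] qA[of "-1"] U in auto)
  then have 2: "2 * (LINT y|lborel. indicator A y * q y) - ?V * (2 * \<epsilon>) \<le> L powr ?s * (2 * \<kappa> / ?c + 2 * \<epsilon> * I)"
    using L unfolding powr_minus by (simp add: field_simps)
  have "L powr ?s * (2 * \<kappa> / ?c + 2 * \<epsilon> * I) = 2 * (L powr ?s * (\<kappa> / ?c + \<epsilon> * I))"
    "?V * (2 * \<epsilon>) = 2 * (\<epsilon> * ?V)"
    by (simp_all add: algebra_simps)
  with 2 have "(LINT y|lborel. indicator A y * q y) \<le> \<epsilon> * ?V + L powr ?s * (\<kappa> / ?c + \<epsilon> * I)"
    by linarith
  then show ?thesis
    unfolding I_def integral_min_levy_kernel_scale[OF \<alpha> R(1)] by (simp add: set_lebesgue_integral_def q_def)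
qed

text \<open>The equation is tested only with mollifiers supported in \<open>{w > M - 2 \<epsilon>}\<close>. The centre \<open>z\<close>, a maximum
  point of \<open>mollify w d + \<epsilon> * cap x0 R\<close>, depends on \<open>d\<close>, but the bound does not, so \<open>d\<close> can tend to 0.\<close>

lemma near_max:
  fixes w :: "real^'n \<Rightarrow> real"
  assumes \<alpha>: "0 < \<alpha>" "\<alpha> < 2" and w: "continuous_on UNIV w" and B: "\<And>y. \<bar>w y\<bar> \<le> B" and M: "\<And>y. w y \<le> M"
    and \<epsilon>: "0 < \<epsilon>" and R: "0 < R" "R < L" and x0: "M - \<epsilon> < w x0"
    and sub: "\<And>z d. 0 < d \<Longrightarrow> cball z d \<subseteq> ball x0 (2 * R) \<Longrightarrow> (\<And>y. y \<in> cball z d \<Longrightarrow> M - 2 * \<epsilon> < w y) \<Longrightarrow>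
        frac_laplacian_dist \<alpha> w (\<lambda>y. bump d (z - y)) \<le> \<kappa>"
    and A: "A \<in> sets borel" "A \<subseteq> ball x0 (L - R)"
  shows "(LINT y:A|lborel. M - w y) \<le> \<epsilon> * (unit_ball_vol (real CARD('n)) * L ^ CARD('n)) +
    L powr (real CARD('n) + \<alpha>) * (\<kappa> / c_frac CARD('n) \<alpha> + \<epsilon> * (R powr - \<alpha> *
      (LINT h|lborel. min 1 ((norm (h::real^'n))\<^sup>2) * levy_kernel \<alpha> h)))"
    (is "_ \<le> ?rhs")
proof -
  have wm[measurable]: "w \<in> borel_measurable borel" by (rule borel_measurable_continuous_onI[OF w])
  note [measurable] = A(1)
  have "uniformly_continuous_on (cball x0 (2 * R)) w"
    by (intro compact_uniformly_continuous continuous_on_subset[OF w]) auto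
  then obtain s where s: "0 < s" "\<And>y y'. y \<in> cball x0 (2 * R) \<Longrightarrow> y' \<in> cball x0 (2 * R) \<Longrightarrow> dist y' y < s \<Longrightarrow> dist (w y') (w y) < \<epsilon>"
    unfolding uniformly_continuous_on_def using \<epsilon> by metis
  have "isCont w x0" using w by (simp add: continuous_on_eq_continuous_at)
  moreover have g: "0 < (w x0 - (M - \<epsilon>)) / 2" using x0 by simp
  ultimately obtain s' where s': "0 < s'" "\<And>y. dist y x0 < s' \<Longrightarrow> dist (w y) (w x0) < (w x0 - (M - \<epsilon>)) / 2"
    unfolding continuous_at_eps_delta by metis
  \<comment> \<open>Below R, mollifiers centred in \<open>cball x0 R\<close> stay inside the ball of
    radius 2R; below s/2, w oscillates by less than \<epsilon> on their supports; below s',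
    mollification keeps the value at x0 above M - \<epsilon>.\<close>
  define d0 where "d0 = min R (min (s / 2) s')"
  have d0: "0 < d0" using R s s' by (simp add: d0_def)
  have main: "(LINT y:A|lborel. M - mollify w d y) \<le> ?rhs" if d: "0 < d" "d < d0" for d
  proof -
    let ?m = "mollify w d"
    let ?G = "\<lambda>y. ?m y + \<epsilon> * cap x0 R y"
    have dd: "d < R" "2 * d < s" "d < s'" using d by (auto simp: d0_def)
    have cm: "continuous_on UNIV ?m" by (rule continuous_mollify[OF w B d(1)])
    have "(w x0 + (M - \<epsilon>)) / 2 \<le> ?m x0"
    proof (rule mollify_ge[OF wm B d(1)])
      fix y assume "y \<in> cball x0 d"
      then have "dist (w y) (w x0) < (w x0 - (M - \<epsilon>)) / 2" using dd by (intro s') (auto simp: dist_commute)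
      then show "(w x0 + (M - \<epsilon>)) / 2 \<le> w y" using abs_ge_minus_self[of "w y - w x0"]
        unfolding dist_real_def by (simp add: field_simps)
    qed
    then have "M - \<epsilon> < ?m x0" using x0 by (simp add: field_simps)
    moreover have "cap x0 R x0 = 1" by (simp add: cap_def)
    ultimately have Gx0: "M < ?G x0" by simp
    have "continuous_on (cball x0 R) ?G"
      unfolding cap_def divide_inverse using continuous_on_subset[OF cm]
      by (intro continuous_intros) auto
    then obtain z where z: "z \<in> cball x0 R" "\<And>y. y \<in> cball x0 R \<Longrightarrow> ?G y \<le> ?G z"
      using continuous_attains_sup[of "cball x0 R" ?G] R by auto
    have Gz: "M < ?G z" using Gx0 z(2)[of x0] R by simp
    have mM: "?m y \<le> M" for y by (rule mollify_le[OF wm B d(1)]) (rule M)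
    \<comment> \<open>The maximum over the compact ball is global: outside it the cap vanishes and
      the mollified function is at most M, while the penalised value at x0 already exceeds
      M.\<close>
    have "?G y \<le> ?G z" for y
    proof (cases "y \<in> cball x0 R")
      case False
      then have "R\<^sup>2 \<le> (norm (y - x0))\<^sup>2" using R by (intro power_mono) (auto simp: dist_norm norm_minus_commute)
      then have "cap x0 R y = 0" using R by (simp add: cap_def field_simps)
      then show ?thesis using mM[of y] Gz by simp
    qed (rule z(2))
    moreover have "cap x0 R z \<le> 1" by (simp add: cap_def)
    then have "\<epsilon> * cap x0 R z \<le> \<epsilon>" using \<epsilon> by (simp add: mult_left_le)
    then have mz: "M - \<epsilon> < ?m z" using Gz by linarith
    have sb: "cball z d \<subseteq> ball x0 (2 * R)"
    proof
      fix y assume "y \<in> cball z d"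
      then show "y \<in> ball x0 (2 * R)" using z(1) dd dist_triangle[of x0 y z] by simp
    qed
    have "M - 2 * \<epsilon> < w y" if y: "y \<in> cball z d" for y
    proof -
      \<comment> \<open>The mollified value is an average of w over \<open>cball z d\<close>, where
        w varies by less than \<epsilon>; hence a value above M - \<epsilon> at z forces w > M -
        2\<epsilon> on that ball.\<close>
      have "?m z \<le> w y + \<epsilon>"
      proof (rule mollify_le[OF wm B d(1)])
        fix y' assume y': "y' \<in> cball z d"
        have "dist y' y \<le> dist z y' + dist z y" by (rule dist_triangle3)
        then have "dist y' y < s" using y y' dd by simp
        then have "dist (w y') (w y) < \<epsilon>"
          using y y' sb by (intro s(2)) (auto intro: less_imp_le simp: subset_eq)
        then show "w y' \<le> w y + \<epsilon>" by (simp add: dist_real_def)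
      qed
      then show ?thesis using mz by linarith
    qed
    then have "frac_laplacian_dist \<alpha> w (\<lambda>y. bump d (z - y)) \<le> \<kappa>"
      using sub[OF d(1) sb] by blast
    ultimately show ?thesis
      using near_max_mollified[OF \<alpha> w B M \<epsilon> R d(1) _ _ _ _ A, of z \<kappa>] z(1) Gz by auto
  qed
  \<comment> \<open>The offset 2 keeps every term, including the first, strictly below
    \<open>d0\<close>.\<close>
  define X where "X i = d0 / real (i + 2)" for i
  have X: "0 < X i" "X i < d0" for i using d0 by (auto simp: X_def field_simps add_pos_nonneg)
  have X0: "X \<longlonglongrightarrow> 0"
    unfolding X_def by (rule LIMSEQ_ignore_initial_segment[OF lim_const_over_n])
  have "(\<lambda>i. LINT y:A|lborel. M - mollify w (X i) y) \<longlonglongrightarrow> (LINT y:A|lborel. M - w y)"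
    unfolding set_lebesgue_integral_def
  proof (rule integral_dominated_convergence[where w="\<lambda>y. indicator A y * (\<bar>M\<bar> + B)"])
    have "emeasure lborel A \<le> emeasure lborel (ball x0 (L - R))" using A by (intro emeasure_mono) auto
    then have "emeasure lborel A < \<infinity>" using emeasure_lborel_ball_finite[of x0 "L - R"] by (rule order.strict_trans1)
    then show "integrable lborel (\<lambda>y. indicator A y * (\<bar>M\<bar> + B))"
      by (intro integrable_mult_left integrable_real_indicator) auto
    have [measurable]: "mollify w (X i) \<in> borel_measurable borel" for i
      by (rule borel_measurable_continuous_onI[OF continuous_mollify[OF w B X(1)]])
    show "(\<lambda>y. indicat_real A y *\<^sub>R (M - mollify w (X i) y)) \<in> borel_measurable lborel" for i by measurable
    show "AE y in lborel. (\<lambda>i. indicat_real A y *\<^sub>R (M - mollify w (X i) y)) \<longlonglongrightarrow> indicat_real A y *\<^sub>R (M - w y)"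
      by (intro always_eventually allI tendsto_intros mollify_tendsto[OF w B X0 X(1)])
    have "\<bar>M - mollify w (X i) y\<bar> \<le> \<bar>M\<bar> + B" for i y
    proof -
      have "mollify w (X i) y \<le> B" by (rule mollify_le[OF wm B X(1)]) (use B in \<open>auto simp: abs_le_iff\<close>)
      moreover have "- B \<le> mollify w (X i) y"
        by (rule mollify_ge[OF wm B X(1)]) (use B in \<open>auto simp: abs_le_iff minus_le_iff\<close>)
      ultimately show ?thesis by linarith
    qed
    then show "AE y in lborel. norm (indicat_real A y *\<^sub>R (M - mollify w (X i) y)) \<le> indicator A y * (\<bar>M\<bar> + B)" for i
      by (intro always_eventually) (auto simp: indicator_def)
  qed measurable
  then show ?thesis
    by (rule LIMSEQ_le_const2) (use main X in blast)
qed

section \<open>Comparison of a solution with its dilations\<close>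

text \<open>(F0) controls f only on \<Omega> times [0,1]; the indicator and the range of v confine
  the composition to that set.\<close>

lemma measurable_source:
  fixes f :: "real^'n \<Rightarrow> real \<Rightarrow> real"
  assumes F0: "F0 \<Omega> f" and \<Omega>: "open \<Omega>" and v: "continuous_on UNIV v" "\<And>y. v y \<in> {0..1}"
  shows "(\<lambda>y. indicator \<Omega> y * f y (v y)) \<in> borel_measurable borel"
    and "\<exists>C. \<forall>y. \<bar>indicator \<Omega> y * f y (v y)\<bar> \<le> C"
proof -
  have [measurable]: "v \<in> borel_measurable borel" by (rule borel_measurable_continuous_onI[OF v(1)])
  have "(\<lambda>y. (y, v y)) \<in> borel \<rightarrow>\<^sub>M borel" by measurable
  then have "(\<lambda>y. (y, v y)) \<in> restrict_space borel \<Omega> \<rightarrow>\<^sub>M restrict_space borel (\<Omega> \<times> {0..1})"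
    using v(2) by (intro measurable_restrict_space2 measurable_restrict_space1) (auto simp: space_restrict_space)
  moreover have "case_prod f \<in> borel_measurable (restrict_space borel (\<Omega> \<times> {0..1}))"
    using F0 by (simp add: F0_def)
  ultimately have "(\<lambda>y. case_prod f (y, v y)) \<in> borel_measurable (restrict_space borel \<Omega>)"
    by (rule measurable_compose)
  then have "(\<lambda>y. f y (v y)) \<in> borel_measurable (restrict_space borel \<Omega>)"
    by simp
  then show "(\<lambda>y. indicator \<Omega> y * f y (v y)) \<in> borel_measurable borel"
    using \<Omega> by (subst (asm) borel_measurable_restrict_space_iff) auto
  obtain C where C: "\<And>p. p \<in> \<Omega> \<times> {0..1} \<Longrightarrow> \<bar>case_prod f p\<bar> \<le> C"
    using F0 unfolding F0_def bounded_iff by (auto simp: image_iff)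
  have "\<bar>indicator \<Omega> y * f y (v y)\<bar> \<le> max C 0" for y
    using C[of "(y, v y)"] v(2)[of y] by (auto simp: indicator_def)
  then show "\<exists>C. \<forall>y. \<bar>indicator \<Omega> y * f y (v y)\<bar> \<le> C" by blast
qed

text \<open>The equation is used for u near z and, after scaling, near t z. The resulting source is
  k(y) - t^\<alpha> k(t y), and (F1) at the level u(t y) compares its second term with the values at
  y. The bound \<kappa> leaves open how f depends on its second argument: it becomes 0 under (F3)
  and a multiple of \<epsilon> under (F2).\<close>

lemma frac_laplacian_dist_dilation_diff_le:
  fixes u :: "real^'n \<Rightarrow> real"
  assumes \<alpha>: "0 < \<alpha>" "\<alpha> < 2" and D0: "open D0"
    and sol: "solution_P \<alpha> D0 D1 f u" and u01: "\<And>x. 0 \<le> u x \<and> u x \<le> 1"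
    and F0: "F0 (D0 - closure D1) f" and F1: "F1 \<alpha> (D0 - closure D1) f"
    and t: "1 \<le> t" and d: "0 < d"
    and sub: "\<And>y. y \<in> cball z d \<Longrightarrow> y \<in> D0 - closure D1 \<and> t *\<^sub>R y \<in> D0 - closure D1"
    and \<kappa>: "\<And>y. y \<in> cball z d \<Longrightarrow> f y (u y) - f y (u (t *\<^sub>R y)) \<le> \<kappa>"
  shows "frac_laplacian_dist \<alpha> (\<lambda>x. u (t *\<^sub>R x) - u x) (\<lambda>y. bump d (z - y)) \<le> \<kappa>"
proof -
  let ?\<Omega> = "D0 - closure D1"
  define k where "k y = indicator ?\<Omega> y * f y (u y)" for y
  have \<Omega>: "open ?\<Omega>" using D0 by (intro open_Diff) auto
  have uc: "continuous_on UNIV u" using sol by (simp add: solution_P_def)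
  have um[measurable]: "u \<in> borel_measurable borel" by (rule borel_measurable_continuous_onI[OF uc])
  have ub: "\<bar>u x\<bar> \<le> 1" for x using u01[of x] by simp
  have utm: "(\<lambda>x. u (t *\<^sub>R x)) \<in> borel_measurable borel" by measurable
  have km[measurable]: "k \<in> borel_measurable borel"
    unfolding k_def using u01 by (intro measurable_source(1)[OF F0 \<Omega> uc]) auto
  obtain C where C: "\<And>y. \<bar>k y\<bar> \<le> C"
    unfolding k_def using measurable_source(2)[OF F0 \<Omega> uc] u01 by auto
  have t0: "0 < t" using t by simp
  have eq: "frac_laplacian_dist \<alpha> u (\<lambda>y. bump s (a - y)) = - mollify k s a"
    if "0 < s" "cball a s \<subseteq> ?\<Omega>" for a s
  proof -
    have "- frac_laplacian_dist \<alpha> u (\<lambda>y. bump s (a - y)) = (LINT x:?\<Omega>|lborel. f x (u x) * bump s (a - x))"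
      using sol test_function_bump[OF that] unfolding solution_P_def by blast
    also have "\<dots> = mollify k s a"
      unfolding mollify_def set_lebesgue_integral_def k_def by (simp add: mult.assoc)
    finally show ?thesis by simp
  qed
  have "cball (t *\<^sub>R z) (t * d) \<subseteq> ?\<Omega>"
  proof
    fix y assume y: "y \<in> cball (t *\<^sub>R z) (t * d)"
    define x where "x = y /\<^sub>R t"
    have yx: "y = t *\<^sub>R x" using t0 by (simp add: x_def)
    have "t * dist z x \<le> t * d" using y t0 by (simp add: yx dist_norm flip: scaleR_diff_right)
    then show "y \<in> ?\<Omega>" using sub[of x] t0 yx by simp
  qed
  then have "frac_laplacian_dist \<alpha> (\<lambda>x. u (t *\<^sub>R x)) (\<lambda>y. bump d (z - y)) = - (t powr \<alpha> * mollify (\<lambda>x. k (t *\<^sub>R x)) d z)"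
    unfolding frac_laplacian_dist_dilation[OF \<alpha> um ub t0 d] mollify_dilation[OF km t0 d]
    using eq[of "t * d" "t *\<^sub>R z"] t0 d by simp
  moreover have "frac_laplacian_dist \<alpha> u (\<lambda>y. bump d (z - y)) = - mollify k d z"
    using sub by (intro eq d) auto
  ultimately have "frac_laplacian_dist \<alpha> (\<lambda>x. u (t *\<^sub>R x) - u x) (\<lambda>y. bump d (z - y))
      = mollify k d z - t powr \<alpha> * mollify (\<lambda>x. k (t *\<^sub>R x)) d z"
    by (subst frac_laplacian_dist_bump_diff[OF \<alpha> utm ub um ub d]) simp
  also have "t powr \<alpha> * mollify (\<lambda>x. k (t *\<^sub>R x)) d z = mollify (\<lambda>x. t powr \<alpha> * k (t *\<^sub>R x)) d z"
    by (simp add: mollify_def mult.assoc flip: integral_mult_right_zero)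
  also have "mollify k d z - \<dots> = mollify (\<lambda>x. k x - t powr \<alpha> * k (t *\<^sub>R x)) d z"
  proof (rule mollify_diff[symmetric, OF km C _ _ d])
    show "\<bar>t powr \<alpha> * k (t *\<^sub>R y)\<bar> \<le> t powr \<alpha> * C" for y
      using C[of "t *\<^sub>R y"] by (simp add: abs_mult mult_left_mono)
  qed measurable
  also have "\<dots> \<le> \<kappa>"
  proof (rule mollify_le[OF _ _ d])
    show "\<bar>k y - t powr \<alpha> * k (t *\<^sub>R y)\<bar> \<le> C + t powr \<alpha> * C" for y
    proof -
      have "\<bar>t powr \<alpha> * k (t *\<^sub>R y)\<bar> \<le> t powr \<alpha> * C"
        using C[of "t *\<^sub>R y"] by (simp add: abs_mult mult_left_mono)
      then show ?thesis using C[of y] by linarith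
    qed
    fix y assume y: "y \<in> cball z d"
    have "f y (u (t *\<^sub>R y)) \<le> t powr \<alpha> * f (t *\<^sub>R y) (u (t *\<^sub>R y))"
      using F1 sub[OF y] t u01 unfolding F1_def by auto
    then show "k y - t powr \<alpha> * k (t *\<^sub>R y) \<le> \<kappa>"
      using \<kappa>[OF y] sub[OF y] by (simp add: k_def)
  qed measurable
  finally show ?thesis .
qed

section \<open>Weak comparison under the monotonicity condition (F3)\<close>

lemma starshaped_closure:
  assumes "starshaped A"
  shows "starshaped (closure A)"
  unfolding starshaped_def
proof
  fix s :: real assume "s \<in> {0..1}"
  then have "(\<lambda>x. s *\<^sub>R x) ` A \<subseteq> A" using assms by (simp add: starshaped_def)
  then show "(\<lambda>x. s *\<^sub>R x) ` closure A \<subseteq> closure A"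
    by (metis closure_mono closure_scaleR)
qed

text \<open>The supremum of w may be approached only by points escaping to infinity or converging to
  0. Therefore \<epsilon> is fixed before the near-maximum point x0, and the estimate is homogeneous
  in \<rho> = |x0|: both sides carry \<rho>^N, which cancels.\<close>

lemma dilation_le_of_monotone:
  fixes u :: "real^'n \<Rightarrow> real"
  assumes \<alpha>: "0 < \<alpha>" "\<alpha> < 2" and D0: "open D0" "starshaped D0"
    and D1: "starshaped D1"
    and F0: "F0 (D0 - closure D1) f" and F1: "F1 \<alpha> (D0 - closure D1) f" and F3: "F3 (D0 - closure D1) f"
    and sol: "solution_P \<alpha> D0 D1 f u" and u01: "\<And>x. 0 \<le> u x \<and> u x \<le> 1"
    and t: "1 < t"
  shows "u (t *\<^sub>R x) \<le> u x"
proof (rule ccontr)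
  assume neg: "\<not> u (t *\<^sub>R x) \<le> u x"
  let ?\<Omega> = "D0 - closure D1"
  define w where "w y = u (t *\<^sub>R y) - u y" for y
  have uc: "continuous_on UNIV u" using sol by (simp add: solution_P_def)
  have wc: "continuous_on UNIV w"
    unfolding w_def by (intro continuous_intros continuous_on_compose2[OF uc]) auto
  have um[measurable]: "u \<in> borel_measurable borel" by (rule borel_measurable_continuous_onI[OF uc])
  have wm[measurable]: "w \<in> borel_measurable borel" by (rule borel_measurable_continuous_onI[OF wc])
  have wb: "\<bar>w y\<bar> \<le> 1" for y using u01[of y] u01[of "t *\<^sub>R y"] by (simp add: w_def abs_le_iff)
  have bdd: "bdd_above (range w)" using wb by (auto simp: bdd_above_def abs_le_iff intro!: exI[of _ 1])
  define M where "M = (SUP y. w y)"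
  have wM: "w y \<le> M" for y unfolding M_def by (rule cSUP_upper[OF _ bdd]) simp
  have M: "0 < M" using neg wM[of x] by (simp add: w_def)
  \<comment> \<open>If u(y) < u(t y), then u(y) < 1 and u(t y) > 0, which keeps y off
    \<open>closure D1\<close> and t y in D0. Starshapedness gives the other two memberships.\<close>
  have pos: "y \<in> ?\<Omega> \<and> t *\<^sub>R y \<in> ?\<Omega>" if "0 < w y" for y
  proof -
    have lt: "u y < u (t *\<^sub>R y)" using that by (simp add: w_def)
    have s: "(1 / t) \<in> {0..1}" and yt: "y = (1 / t) *\<^sub>R (t *\<^sub>R y)" using t by auto
    have "t *\<^sub>R y \<in> D0"
    proof (rule ccontr)
      assume "t *\<^sub>R y \<notin> D0"
      then have "u (t *\<^sub>R y) = 0" using sol by (simp add: solution_P_def)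
      then show False using lt u01[of y] by simp
    qed
    moreover from this have "y \<in> D0"
      using D0(2) s yt unfolding starshaped_def by (metis image_subset_iff)
    moreover have y1: "y \<notin> closure D1"
    proof
      assume "y \<in> closure D1"
      then have "u y = 1" using sol by (simp add: solution_P_def)
      then show False using lt u01[of "t *\<^sub>R y"] by simp
    qed
    moreover have "t *\<^sub>R y \<notin> closure D1"
      using y1 starshaped_closure[OF D1] s yt unfolding starshaped_def by (metis image_subset_iff)
    ultimately show ?thesis by simp
  qed
  \<comment> \<open>The telescoping sum of k values of w is at most 1, so k M >= 2 leaves a total
    gap of at least 1 at every point.\<close>
  obtain k :: nat where k: "2 / M < real k" using reals_Archimedean2 by blast
  have kM: "2 \<le> real k * M" using k M by (simp add: field_simps)
  let ?N = "CARD('n)"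
  let ?s = "real ?N + \<alpha>"
  let ?V = "unit_ball_vol (real ?N)"
  define I where "I = (LINT h|lborel. min 1 ((norm (h::real^'n))\<^sup>2) * levy_kernel \<alpha> h)"
  \<comment> \<open>With R = \<rho> and L = (t^k + 2)\<rho>, the bound of \<open>near_max\<close>
    for \<kappa> = 0 is exactly \<epsilon> \<rho>^N Q.\<close>
  define Q where "Q = ?V * (t ^ k + 2) ^ ?N + (t ^ k + 2) powr ?s * I"
  \<comment> \<open>The first bound makes w positive wherever w > M - 2\<epsilon>, so that the
    equation is available there; the second makes k \<epsilon> Q at most half the volume of the unit
    ball.\<close>
  define \<epsilon> where "\<epsilon> = min (M / 2) (?V / (2 * real k * Q))"
  have V: "0 < ?V" by simp
  have tk: "0 < t ^ k + 2" using t by (simp add: add_pos_pos)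
  have "0 \<le> I" unfolding I_def by (rule Bochner_Integration.integral_nonneg) simp
  then have Q: "0 < Q" unfolding Q_def using V tk by (intro add_pos_nonneg mult_pos_pos) auto
  have k0: "0 < real k" using kM by (cases "k = 0") auto
  have \<epsilon>: "0 < \<epsilon>" "2 * \<epsilon> \<le> M" using M V Q k0 by (auto simp: \<epsilon>_def)
  have "real k * \<epsilon> * Q \<le> real k * (?V / (2 * real k * Q)) * Q"
    using k0 Q by (intro mult_right_mono mult_left_mono) (auto simp: \<epsilon>_def)
  also have "\<dots> = ?V / 2" using k0 Q by (simp add: field_simps)
  also have "\<dots> < ?V" using V by simp
  finally have \<epsilon>Q: "real k * \<epsilon> * Q < ?V" .
  obtain x0 where x0: "M - \<epsilon> < w x0"
    using less_cSUP_iff[OF _ bdd, of "M - \<epsilon>"] \<epsilon> by (auto simp: M_def)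
  define \<rho> where "\<rho> = norm x0"
  \<comment> \<open>The origin is fixed by dilation, so w vanishes there and it is no near-maximum
    point.\<close>
  have "x0 \<noteq> 0"
  proof
    assume "x0 = 0"
    then have "w x0 = 0" by (simp add: w_def)
    then show False using x0 \<epsilon> M by linarith
  qed
  then have \<rho>: "0 < \<rho>" by (simp add: \<rho>_def)
  \<comment> \<open>L - \<rho> = (t^k + 1)\<rho>, so the ball about x0 of this radius contains all
    balls about 0 of radius t^j \<rho> with j < k.\<close>
  define L where "L = (t ^ k + 2) * \<rho>"
  have "1 * \<rho> < (t ^ k + 2) * \<rho>" using \<rho> t by (intro mult_strict_right_mono) (auto simp: add_pos_pos)
  then have RL: "\<rho> < L" by (simp add: L_def)
  let ?B = "ball (0::real^'n) \<rho>"
  have [measurable]: "?B \<in> sets borel" by simp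
  have est: "(LINT y:ball 0 (t ^ j * \<rho>)|lborel. M - w y) \<le> \<epsilon> * \<rho> ^ ?N * Q" if "j < k" for j
  proof -
    have "(LINT y:ball 0 (t ^ j * \<rho>)|lborel. M - w y) \<le> \<epsilon> * (?V * L ^ ?N) +
      L powr ?s * (0 / c_frac ?N \<alpha> + \<epsilon> * (\<rho> powr - \<alpha> * I))"
      unfolding I_def
    proof (rule near_max[OF \<alpha> wc wb wM \<epsilon>(1) \<rho> RL x0])
      show "ball 0 (t ^ j * \<rho>) \<subseteq> ball x0 (L - \<rho>)"
      proof
        fix y :: "real^'n" assume "y \<in> ball 0 (t ^ j * \<rho>)"
        then have "norm y < t ^ j * \<rho>" by simp
        also have "\<dots> \<le> t ^ k * \<rho>" using that t \<rho> by (intro mult_right_mono power_increasing) auto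
        finally have "norm y < t ^ k * \<rho>" .
        then show "y \<in> ball x0 (L - \<rho>)"
          using norm_triangle_ineq4[of x0 y] by (simp add: dist_norm L_def algebra_simps \<rho>_def)
      qed
    next
      fix z d assume d: "0 < d" and wy: "\<And>y. y \<in> cball z d \<Longrightarrow> M - 2 * \<epsilon> < w y"
      have wp: "0 < w y" if "y \<in> cball z d" for y using wy[OF that] \<epsilon>(2) by linarith
      show "frac_laplacian_dist \<alpha> w (\<lambda>y. bump d (z - y)) \<le> 0"
        unfolding w_def
      proof (rule frac_laplacian_dist_dilation_diff_le[OF \<alpha> D0(1) sol u01 F0 F1 _ d])
        fix y assume y: "y \<in> cball z d"
        show "y \<in> ?\<Omega> \<and> t *\<^sub>R y \<in> ?\<Omega>" by (rule pos[OF wp[OF y]])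
        then show "f y (u y) - f y (u (t *\<^sub>R y)) \<le> 0"
          using F3 wp[OF y] u01 unfolding F3_def w_def by auto
      qed (use t in auto)
    qed simp
    also have "L powr ?s * (0 / c_frac ?N \<alpha> + \<epsilon> * (\<rho> powr - \<alpha> * I)) = \<epsilon> * \<rho> ^ ?N * ((t ^ k + 2) powr ?s * I)"
    proof -
      have "\<rho> powr ?s * \<rho> powr - \<alpha> = \<rho> ^ ?N" using \<rho> by (simp add: powr_realpow flip: powr_add)
      then show ?thesis using \<rho> tk by (simp add: L_def powr_mult mult_ac)
    qed
    also have "\<epsilon> * (?V * L ^ ?N) = \<epsilon> * \<rho> ^ ?N * (?V * (t ^ k + 2) ^ ?N)" by (simp add: L_def power_mult_distrib)
    finally show ?thesis by (simp add: Q_def algebra_simps)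
  qed
  have wM1: "\<bar>M - w y\<bar> \<le> M + 1" for y using wM[of y] wb[of y] by linarith
  have int: "integrable lborel (\<lambda>y. indicator ?B y * (M - w (c *\<^sub>R y)))" for c
    by (rule integrable_bounded_support[where a=0 and r=\<rho> and B="M + 1"])
       (use M wM1 in \<open>auto simp: indicator_def\<close>)
  have est2: "(LINT y|lborel. indicator ?B y * (M - w (t ^ j *\<^sub>R y))) \<le> \<epsilon> * \<rho> ^ ?N * Q" if "j < k" for j
  proof -
    let ?g = "\<lambda>y. indicator (ball 0 (t ^ j * \<rho>)) y * (M - w y)"
    let ?i = "LINT y|lborel. indicator ?B y * (M - w (t ^ j *\<^sub>R y))"
    have tj: "1 \<le> t ^ j" "0 < t ^ j" using t by auto
    have [measurable]: "ball (0::real^'n) (t ^ j * \<rho>) \<in> sets borel" by simp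
    have "?g \<in> borel_measurable borel" by measurable
    from integral_lborel_affine[OF this, of "t ^ j" 0]
    have "(LINT y|lborel. ?g y) = (t ^ j) ^ ?N * (LINT y|lborel. ?g (t ^ j *\<^sub>R y))" using tj t by simp
    also have "(LINT y|lborel. ?g (t ^ j *\<^sub>R y)) = ?i"
      using tj by (intro Bochner_Integration.integral_cong) (auto simp: indicator_def)
    finally have eq: "(LINT y|lborel. ?g y) = (t ^ j) ^ ?N * ?i" .
    have "0 \<le> ?i" by (intro Bochner_Integration.integral_nonneg) (simp add: wM)
    \<comment> \<open>The Jacobian is at least 1 and the gap nonnegative, so rescaling to the ball
      of radius \<rho> keeps the upper bound.\<close>
    then have "1 * ?i \<le> (t ^ j) ^ ?N * ?i" using tj t by (intro mult_right_mono one_le_power) auto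
    then have "?i \<le> (LINT y|lborel. ?g y)" using eq by simp
    also have "\<dots> \<le> \<epsilon> * \<rho> ^ ?N * Q" using est[OF that] by (simp add: set_lebesgue_integral_def)
    finally show ?thesis .
  qed
  have tel: "(\<Sum>j<m. w (t ^ j *\<^sub>R y)) = u (t ^ m *\<^sub>R y) - u y" for m y
    by (induction m) (simp_all add: w_def)
  \<comment> \<open>Integrating the pointwise total gap of at least 1 gives the volume of the ball,
    while the k estimates sum to strictly less.\<close>
  have "?V * \<rho> ^ ?N = (LINT y|lborel. indicator ?B y * 1)" using \<rho> by (simp add: content_ball)
  also have "\<dots> \<le> (LINT y|lborel. (\<Sum>j<k. indicator ?B y * (M - w (t ^ j *\<^sub>R y))))"
  proof (rule integral_mono)
    show "integrable lborel (\<lambda>y. indicator ?B y * 1 :: real)"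
      by (rule integrable_bounded_support[where a=0 and r=\<rho> and B=1]) (auto simp: indicator_def)
    show "integrable lborel (\<lambda>y. \<Sum>j<k. indicator ?B y * (M - w (t ^ j *\<^sub>R y)))"
      by (intro Bochner_Integration.integrable_sum int)
    fix y
    have "(\<Sum>j<k. M - w (t ^ j *\<^sub>R y)) = real k * M - (u (t ^ k *\<^sub>R y) - u y)"
      by (simp add: sum_subtractf tel)
    then have "1 \<le> (\<Sum>j<k. M - w (t ^ j *\<^sub>R y))"
      using kM u01[of "t ^ k *\<^sub>R y"] u01[of y] by linarith
    then show "indicator ?B y * 1 \<le> (\<Sum>j<k. indicator ?B y * (M - w (t ^ j *\<^sub>R y)))"
      unfolding sum_distrib_left[symmetric] by (intro mult_left_mono) auto
  qed
  also have "\<dots> = (\<Sum>j<k. LINT y|lborel. indicator ?B y * (M - w (t ^ j *\<^sub>R y)))"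
    by (intro Bochner_Integration.integral_sum int)
  also have "\<dots> \<le> (\<Sum>j<k. \<epsilon> * \<rho> ^ ?N * Q)" by (intro sum_mono est2) auto
  also have "\<dots> = (real k * \<epsilon> * Q) * \<rho> ^ ?N" by simp
  also have "\<dots> < ?V * \<rho> ^ ?N" using \<epsilon>Q \<rho> by (intro mult_strict_right_mono) auto
  finally show False by simp
qed

section \<open>Strict comparison for bounded strictly starshaped sets\<close>

text \<open>If s x were outside D, the segment from 0 to s x would meet the frontier at a parameter
  at most s < 1. The same ray also meets it at a parameter at least 1, because x lies in the closure
  and D is bounded. Uniqueness excludes this.\<close>

lemma strictly_starshaped_scaleR_mem:
  fixes D :: "(real^'n) set"
  assumes D: "strictly_starshaped D" "open D" "bounded D" and x: "x \<in> closure D" and s: "0 \<le> s" "s < 1"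
  shows "s *\<^sub>R x \<in> D"
proof (rule ccontr)
  assume sx: "s *\<^sub>R x \<notin> D"
  have 0: "0 \<in> D" using D by (auto simp: strictly_starshaped_def interior_open)
  then have x0: "x \<noteq> 0" using sx by auto
  have "closed_segment 0 (s *\<^sub>R x) \<inter> frontier D \<noteq> {}"
    by (rule connected_Int_frontier) (use 0 sx in auto)
  then obtain c where c: "0 \<le> c" "c \<le> 1" "(c * s) *\<^sub>R x \<in> frontier D"
    by (auto simp: in_segment)
  have "\<exists>b\<ge>1. b *\<^sub>R x \<in> frontier D"
  proof (cases "x \<in> D")
    case True
    obtain r where r: "\<And>y. y \<in> D \<Longrightarrow> norm y \<le> r" using D(3) by (auto simp: bounded_iff)
    have r0: "0 \<le> r" using r[OF 0] by simp
    \<comment> \<open>This factor gives T x the norm |x| + r, beyond every point of D.\<close>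
    define T where "T = 1 + r / norm x"
    have "r < norm (T *\<^sub>R x)" using x0 r0 by (simp add: T_def distrib_right)
    then have "T *\<^sub>R x \<notin> D" using r by fastforce
    then have "closed_segment x (T *\<^sub>R x) \<inter> frontier D \<noteq> {}"
      using True by (intro connected_Int_frontier) auto
    then obtain e where e: "0 \<le> e" "e \<le> 1" "(1 - e + e * T) *\<^sub>R x \<in> frontier D"
      by (auto simp: in_segment scaleR_add_left)
    have "1 \<le> T" using r0 by (simp add: T_def)
    then have "1 \<le> 1 - e + e * T" using e mult_left_mono[of 1 T e] by simp
    then show ?thesis using e by blast
  next
    case False
    then have "x \<in> frontier D" using x D(2) by (simp add: frontier_def interior_open)
    then show ?thesis by (intro exI[of _ 1]) auto
  qed
  then obtain b where b: "1 \<le> b" "b *\<^sub>R x \<in> frontier D" by blast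
  have "\<exists>!y. y \<in> {s *\<^sub>R x | s. 0 \<le> s} \<and> y \<in> frontier D" using D(1) x0 by (simp add: strictly_starshaped_def)
  moreover have "(c * s) *\<^sub>R x \<in> {s *\<^sub>R x | s. 0 \<le> s}" "b *\<^sub>R x \<in> {s *\<^sub>R x | s. 0 \<le> s}"
    using c b s by (fastforce intro: mult_nonneg_nonneg)+
  ultimately have "(c * s) *\<^sub>R x = b *\<^sub>R x" using c(3) b(2) by blast
  then have "c * s = b" using x0 by simp
  moreover have "c * s \<le> 1 * s" using c s by (intro mult_right_mono) auto
  ultimately show False using b s by simp
qed

text \<open>A strong maximum principle. At a touching point w attains its maximum 0, so
  \<open>near_max\<close> applies with x0 and R fixed and every \<epsilon> > 0, with a bound linear
  in \<epsilon>. The mean of -w over any ball is then 0, although w is negative somewhere inside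
  D0.\<close>

lemma dilation_less_of_le:
  fixes u :: "real^'n \<Rightarrow> real"
  assumes \<alpha>: "0 < \<alpha>" "\<alpha> < 2" and D0: "open D0" "strictly_starshaped D0" "bounded D0"
    and D1: "open D1" "strictly_starshaped D1" "bounded D1"
    and F0: "F0 (D0 - closure D1) f" and F1: "F1 \<alpha> (D0 - closure D1) f" and F2: "F2 (D0 - closure D1) f"
    and sol: "solution_P \<alpha> D0 D1 f u" and u01: "\<And>x. 0 \<le> u x \<and> u x \<le> 1"
    and u_pos: "\<And>x. x \<in> D0 \<Longrightarrow> 0 < u x" and u_less: "\<And>x. x \<notin> closure D1 \<Longrightarrow> u x < 1"
    and t: "1 < t" and le: "\<And>x. u (t *\<^sub>R x) \<le> u x"
    and x0: "x0 \<notin> D1" "t *\<^sub>R x0 \<in> closure D0"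
  shows "u (t *\<^sub>R x0) < u x0"
proof (rule ccontr)
  assume neg: "\<not> u (t *\<^sub>R x0) < u x0"
  let ?\<Omega> = "D0 - closure D1"
  \<comment> \<open>A touching point and its dilate both lie in D0 - \<open>closure D1\<close>: u =
    1 at x0 would contradict u < 1 at t x0, and u = 0 at t x0 would contradict u > 0 at x0.\<close>
  have x0t: "x0 = (1 / t) *\<^sub>R (t *\<^sub>R x0)" and t1: "0 \<le> 1 / t" "1 / t < 1" using t by auto
  have x0D0: "x0 \<in> D0"
    using strictly_starshaped_scaleR_mem[OF D0(2,1,3) x0(2) t1] x0t by simp
  have tx0: "t *\<^sub>R x0 \<notin> closure D1"
    using strictly_starshaped_scaleR_mem[OF D1(2,1,3) _ t1, of "t *\<^sub>R x0"] x0t x0(1) by auto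
  have "x0 \<notin> closure D1"
  proof
    assume "x0 \<in> closure D1"
    then have "u x0 = 1" using sol by (simp add: solution_P_def)
    then show False using neg u_less[OF tx0] by simp
  qed
  moreover have "t *\<^sub>R x0 \<in> D0"
  proof (rule ccontr)
    assume "t *\<^sub>R x0 \<notin> D0"
    then have "u (t *\<^sub>R x0) = 0" using sol by (simp add: solution_P_def)
    then show False using neg u_pos[OF x0D0] by simp
  qed
  ultimately have x0\<Omega>: "x0 \<in> ?\<Omega>" "t *\<^sub>R x0 \<in> ?\<Omega>" using x0D0 tx0 by auto
  define w where "w y = u (t *\<^sub>R y) - u y" for y
  have uc: "continuous_on UNIV u" using sol by (simp add: solution_P_def)
  have wc: "continuous_on UNIV w"
    unfolding w_def by (intro continuous_intros continuous_on_compose2[OF uc]) auto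
  have wm[measurable]: "w \<in> borel_measurable borel" by (rule borel_measurable_continuous_onI[OF wc])
  have wb: "\<bar>w y\<bar> \<le> 1" for y using u01[of y] u01[of "t *\<^sub>R y"] by (simp add: w_def abs_le_iff)
  have w0: "w y \<le> 0" for y using le[of y] by (simp add: w_def)
  have wx0: "w x0 = 0" using neg w0[of x0] by (simp add: w_def)
  have \<Omega>: "open ?\<Omega>" using D0 by (intro open_Diff) auto
  have "open ((\<lambda>y. t *\<^sub>R y) -` ?\<Omega>)" by (intro open_vimage \<Omega> continuous_intros)
  then have "open (?\<Omega> \<inter> (\<lambda>y. t *\<^sub>R y) -` ?\<Omega>)" using \<Omega> by (rule open_Int[rotated])
  then obtain R' where R': "0 < R'" "ball x0 R' \<subseteq> ?\<Omega> \<inter> (\<lambda>y. t *\<^sub>R y) -` ?\<Omega>"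
    using x0\<Omega> open_contains_ball by (metis IntI vimageI)
  \<comment> \<open>Halved because \<open>near_max\<close> tests the equation in the ball of radius
    2R.\<close>
  define R where "R = R' / 2"
  have R: "0 < R" "ball x0 (2 * R) \<subseteq> ?\<Omega> \<inter> (\<lambda>y. t *\<^sub>R y) -` ?\<Omega>" using R' by (auto simp: R_def)
  obtain C where C: "0 < C" "\<And>x u1 u2. x \<in> ?\<Omega> \<Longrightarrow> u1 \<in> {0..1} \<Longrightarrow> u2 \<in> {0..1} \<Longrightarrow> \<bar>f x u1 - f x u2\<bar> \<le> C * \<bar>u1 - u2\<bar>"
    using F2 unfolding F2_def by metis
  have "\<exists>p. w p < 0"
  proof -
    obtain v :: "real^'n" where "v \<noteq> 0" using vector_choose_size[of 1] by (metis norm_zero zero_neq_one zero_le_one)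
    then obtain y where y: "y \<in> frontier D0" using D0(2) unfolding strictly_starshaped_def by blast
    have yD0: "y \<notin> D0" "y \<in> closure D0" using y D0(1) by (auto simp: frontier_def interior_open)
    \<comment> \<open>Chosen with s < 1 < t s: for a frontier point y of D0, s y is inside D0 and t
      s y outside, so w < 0 at s y.\<close>
    define s where "s = 2 / (1 + t)"
    have s: "0 \<le> s" "s < 1" "1 < t * s" using t by (auto simp: s_def field_simps)
    have "0 < u (s *\<^sub>R y)" by (intro u_pos strictly_starshaped_scaleR_mem[OF D0(2,1,3) yD0(2)] s)
    moreover have "t *\<^sub>R s *\<^sub>R y \<notin> D0"
    proof
      assume "t *\<^sub>R s *\<^sub>R y \<in> D0"
      then have "(t * s) *\<^sub>R y \<in> closure D0" using closure_subset by auto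
      from strictly_starshaped_scaleR_mem[OF D0(2,1,3) this, of "1 / (t * s)"] show False
        using s t yD0(1) by (cases "s = 0") (auto simp: divide_less_eq)
    qed
    then have "u (t *\<^sub>R s *\<^sub>R y) = 0" using sol by (simp add: solution_P_def)
    ultimately show ?thesis by (intro exI[of _ "s *\<^sub>R y"]) (simp add: w_def)
  qed
  then obtain p where p: "w p < 0" by blast
  have "isCont w p" using wc by (simp add: continuous_on_eq_continuous_at)
  then obtain r where r: "0 < r" "\<And>y. dist y p < r \<Longrightarrow> dist (w y) (w p) < - w p / 2"
    using p unfolding continuous_at_eps_delta by (metis half_gt_zero neg_0_less_iff_less minus_divide_left)
  define m where "m = - w p / 2"
  have m: "0 < m" "\<And>y. y \<in> ball p r \<Longrightarrow> m \<le> - w y"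
    using p r(2) by (auto simp: m_def dist_commute dist_real_def abs_less_iff) (fastforce simp: dist_commute dist_real_def abs_less_iff)+
  let ?N = "CARD('n)"
  let ?s = "real ?N + \<alpha>"
  \<comment> \<open>L - R = \<open>dist x0 p + r\<close>, just enough for the ball about x0 to
    contain the ball about p on which w is bounded away from 0.\<close>
  define L where "L = R + dist x0 p + r"
  define I where "I = (LINT h|lborel. min 1 ((norm (h::real^'n))\<^sup>2) * levy_kernel \<alpha> h)"
  \<comment> \<open>The term with C comes from (F2): where |w| < 2\<epsilon>, the two source values
    differ by at most \<kappa> = 2 C \<epsilon>, which makes the whole bound linear in
    \<epsilon>.\<close>
  define Q where "Q = unit_ball_vol (real ?N) * L ^ ?N + L powr ?s * (2 * C / c_frac ?N \<alpha> + R powr - \<alpha> * I)"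
  have RL: "R < L" using r by (simp add: L_def add_nonneg_pos)
  have est: "m * measure lborel (ball p r) \<le> \<epsilon> * Q" if \<epsilon>: "0 < \<epsilon>" for \<epsilon>
  proof -
    have [measurable]: "ball p r \<in> sets borel" by simp
    have "m * measure lborel (ball p r) = (LINT y|lborel. indicator (ball p r) y * m)" by simp
    also have "\<dots> \<le> (LINT y|lborel. indicator (ball p r) y * (0 - w y))"
    proof (rule integral_mono)
      show "integrable lborel (\<lambda>y. indicator (ball p r) y * m)"
        by (rule integrable_bounded_support[where a=p and r=r and B=m]) (use m in \<open>auto simp: indicator_def\<close>)
      show "integrable lborel (\<lambda>y. indicator (ball p r) y * (0 - w y))"
        by (rule integrable_bounded_support[where a=p and r=r and B=1]) (use wb in \<open>auto simp: indicator_def\<close>)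
      show "indicator (ball p r) y * m \<le> indicator (ball p r) y * (0 - w y)" for y
        using m(2)[of y] by (auto simp: indicator_def)
    qed
    also have "\<dots> = (LINT y:ball p r|lborel. 0 - w y)" by (simp add: set_lebesgue_integral_def)
    also have "\<dots> \<le> \<epsilon> * (unit_ball_vol (real ?N) * L ^ ?N) +
      L powr ?s * ((2 * C * \<epsilon>) / c_frac ?N \<alpha> + \<epsilon> * (R powr - \<alpha> * I))"
      unfolding I_def
    proof (rule near_max[OF \<alpha> wc wb w0 \<epsilon> R(1) RL])
      show "0 - \<epsilon> < w x0" using wx0 \<epsilon> by simp
      show "ball p r \<subseteq> ball x0 (L - R)"
      proof
        fix y assume "y \<in> ball p r"
        then show "y \<in> ball x0 (L - R)" using dist_triangle[of x0 y p] by (simp add: L_def)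
      qed
    next
      fix z d assume d: "0 < d" and zd: "cball z d \<subseteq> ball x0 (2 * R)"
        and wy: "\<And>y. y \<in> cball z d \<Longrightarrow> 0 - 2 * \<epsilon> < w y"
      show "frac_laplacian_dist \<alpha> w (\<lambda>y. bump d (z - y)) \<le> 2 * C * \<epsilon>"
        unfolding w_def
      proof (rule frac_laplacian_dist_dilation_diff_le[OF \<alpha> D0(1) sol u01 F0 F1 _ d])
        fix y assume y: "y \<in> cball z d"
        show y\<Omega>: "y \<in> ?\<Omega> \<and> t *\<^sub>R y \<in> ?\<Omega>" using y zd R(2) by blast
        have "f y (u y) - f y (u (t *\<^sub>R y)) \<le> C * \<bar>u y - u (t *\<^sub>R y)\<bar>"
          using C(2)[of y "u y" "u (t *\<^sub>R y)"] y\<Omega> u01 by (auto simp: abs_le_iff)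
        also have "\<dots> \<le> C * (2 * \<epsilon>)"
          using C(1) wy[OF y] w0[of y] by (intro mult_left_mono) (auto simp: w_def)
        finally show "f y (u y) - f y (u (t *\<^sub>R y)) \<le> 2 * C * \<epsilon>" by simp
      qed (use t in auto)
    qed simp
    also have "\<dots> = \<epsilon> * Q" by (simp add: Q_def algebra_simps)
    finally show ?thesis .
  qed
  have pos: "0 < m * measure lborel (ball p r)"
    using m(1) content_ball_pos[OF r(1), of p] by simp
  \<comment> \<open>The estimate with \<epsilon> = 1 shows that Q is positive; the next \<epsilon>
    bounds a positive quantity by half of itself.\<close>
  have "0 < Q" using est[of 1] pos by simp
  then have "m * measure lborel (ball p r) \<le> m * measure lborel (ball p r) / 2"
    using est[of "m * measure lborel (ball p r) / 2 / Q"] pos by simp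
  then show False using pos by simp
qed

text \<open>A sliding argument in the dilation factor. The set of pairs violating strictness is
  compact, so a violation has a largest factor t0. Beyond t0 the weak inequality holds everywhere,
  and it passes to t0 by continuity; the touching pair at t0 contradicts the strong maximum
  principle above.\<close>

lemma dilation_less:
  fixes u :: "real^'n \<Rightarrow> real"
  assumes \<alpha>: "0 < \<alpha>" "\<alpha> < 2" and D0: "open D0" "strictly_starshaped D0" "bounded D0"
    and D1: "open D1" "strictly_starshaped D1" "bounded D1"
    and F0: "F0 (D0 - closure D1) f" and F1: "F1 \<alpha> (D0 - closure D1) f" and F2: "F2 (D0 - closure D1) f"
    and sol: "solution_P \<alpha> D0 D1 f u" and u01: "\<And>x. 0 \<le> u x \<and> u x \<le> 1"
    and u_pos: "\<And>x. x \<in> D0 \<Longrightarrow> 0 < u x" and u_less: "\<And>x. x \<notin> closure D1 \<Longrightarrow> u x < 1"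
    and t: "1 < t" and x: "x \<notin> D1" "t *\<^sub>R x \<in> closure D0"
  shows "u (t *\<^sub>R x) < u x"
proof (rule ccontr)
  assume neg: "\<not> u (t *\<^sub>R x) < u x"
  have uc: "continuous_on UNIV u" using sol by (simp add: solution_P_def)
  have 0: "0 \<in> D1" using D1 by (auto simp: strictly_starshaped_def interior_open)
  obtain r where r: "0 < r" "ball 0 r \<subseteq> D1" using D1(1) 0 open_contains_ball by blast
  obtain b where b: "\<And>y. y \<in> closure D0 \<Longrightarrow> norm y \<le> b"
    using bounded_closure[OF D0(3)] by (auto simp: bounded_iff)
  \<comment> \<open>The complement of the open set D1 and the closure of D0 make Z closed. It is
    bounded because its points y satisfy |y| >= r, while their dilates stay within radius b.\<close>
  define Z where "Z = {p. 1 \<le> fst p} \<inter> {p. snd p \<in> - D1} \<inter> {p. fst p *\<^sub>R snd p \<in> closure D0}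
    \<inter> {p. u (snd p) \<le> u (fst p *\<^sub>R snd p)}"
  have cl: "closed Z"
    unfolding Z_def
    using D1(1)
    by (intro closed_Int closed_Collect_le continuous_intros continuous_on_compose2[OF uc]
        closed_vimage[of "- D1" snd, unfolded vimage_def]
        closed_vimage[of "closure D0" "\<lambda>p. fst p *\<^sub>R snd p", unfolded vimage_def]) auto
  have "Z \<subseteq> {1..b / r} \<times> cball 0 b"
  proof
    fix p assume p: "p \<in> Z"
    obtain s y where sy: "p = (s, y)" by (cases p)
    have *: "1 \<le> s" "y \<notin> D1" "s *\<^sub>R y \<in> closure D0" using p by (auto simp: Z_def sy)
    have "r \<le> norm y" using r *(2) by (force simp: not_less)
    moreover have "s * norm y \<le> b" using b[OF *(3)] *(1) by simp
    moreover have "1 * norm y \<le> s * norm y" using *(1) by (intro mult_right_mono) auto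
    moreover have "s * r \<le> s * norm y" using *(1) \<open>r \<le> norm y\<close> by (intro mult_left_mono) auto
    ultimately have "norm y \<le> b" "s * r \<le> b" by linarith+
    then show "p \<in> {1..b / r} \<times> cball 0 b" using *(1) r(1) by (simp add: sy pos_le_divide_eq)
  qed
  then have "bounded Z" by (rule bounded_subset[rotated]) (intro bounded_Times; simp)
  then have cfZ: "compact (fst ` Z)" using cl
    by (intro compact_continuous_image continuous_intros) (simp add: compact_eq_bounded_closed)
  have "(t, x) \<in> Z" using t x neg by (simp add: Z_def)
  then have tZ: "t \<in> fst ` Z" by (rule image_eqI[rotated]) simp
  obtain t0 where t0: "t0 \<in> fst ` Z" "\<And>s. s \<in> fst ` Z \<Longrightarrow> s \<le> t0"
    using compact_attains_sup[OF cfZ] tZ by blast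
  have t01: "1 < t0" using t0(2)[OF tZ] t by simp
  \<comment> \<open>A strict violation would automatically satisfy the side conditions of Z, because
    u = 1 on D1 is maximal and u = 0 off D0 is minimal.\<close>
  have gt: "u (s *\<^sub>R y) \<le> u y" if s: "t0 < s" for s y
  proof (rule ccontr)
    assume n: "\<not> u (s *\<^sub>R y) \<le> u y"
    have "y \<notin> D1"
    proof
      assume "y \<in> D1"
      then have "u y = 1" using sol closure_subset[of D1] by (auto simp: solution_P_def)
      then show False using n u01[of "s *\<^sub>R y"] by simp
    qed
    moreover have "s *\<^sub>R y \<in> D0"
    proof (rule ccontr)
      assume "s *\<^sub>R y \<notin> D0"
      then have "u (s *\<^sub>R y) = 0" using sol by (simp add: solution_P_def)
      then show False using n u01[of y] by simp
    qed
    ultimately have "(s, y) \<in> Z" using n s t01 closure_subset[of D0] by (auto simp: Z_def)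
    then show False using t0(2)[of s] s by force
  qed
  have le: "u (t0 *\<^sub>R y) \<le> u y" for y
  proof (rule LIMSEQ_le_const2)
    have "(\<lambda>n. (t0 + inverse (real (Suc n))) *\<^sub>R y) \<longlonglongrightarrow> (t0 + 0) *\<^sub>R y"
      by (intro tendsto_intros LIMSEQ_inverse_real_of_nat)
    moreover have "isCont u (t0 *\<^sub>R y)" using uc by (simp add: continuous_on_eq_continuous_at)
    ultimately show "(\<lambda>n. u ((t0 + inverse (real (Suc n))) *\<^sub>R y)) \<longlonglongrightarrow> u (t0 *\<^sub>R y)"
      by (intro isCont_tendsto_compose[of _ u]) auto
    show "\<exists>N. \<forall>n\<ge>N. u ((t0 + inverse (real (Suc n))) *\<^sub>R y) \<le> u y"
      by (intro exI allI impI gt) simp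
  qed
  obtain y where "y \<notin> D1" "t0 *\<^sub>R y \<in> closure D0" "u y \<le> u (t0 *\<^sub>R y)"
    using t0(1) by (auto simp: Z_def)
  then show False
    using dilation_less_of_le[OF \<alpha> D0 D1 F0 F1 F2 sol u01 u_pos u_less t01 le, of y] by simp
qed

section \<open>From dilation inequalities to superlevel sets\<close>

lemma starshaped_superlevel:
  fixes u :: "real^'n \<Rightarrow> real"
  assumes dil: "\<And>t x. 1 < t \<Longrightarrow> u (t *\<^sub>R x) \<le> u x" and 0: "l \<le> u 0"
  shows "starshaped (superlevel u l)"
  unfolding starshaped_def
proof (intro ballI image_subsetI)
  fix s :: real and x assume s: "s \<in> {0..1}" and x: "x \<in> superlevel u l"
  consider "s = 0" | "s = 1" | "0 < s" "s < 1" using s by fastforce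
  then show "s *\<^sub>R x \<in> superlevel u l"
  proof cases
    case 3
    then have "u ((1 / s) *\<^sub>R s *\<^sub>R x) \<le> u (s *\<^sub>R x)" by (intro dil) simp
    then show ?thesis using 3 x by (simp add: superlevel_def)
  qed (use 0 x in \<open>auto simp: superlevel_def\<close>)
qed

text \<open>Frontier points satisfy u = l, since u > l is an open condition. Existence on a ray
  follows from connectedness between 0 and a point beyond D0; uniqueness follows because u decreases
  strictly along the ray outside D1 as long as it stays in D0.\<close>

lemma strictly_starshaped_superlevel:
  fixes u :: "real^'n \<Rightarrow> real"
  assumes uc: "continuous_on UNIV u" and D0: "bounded D0" "\<And>x. x \<notin> D0 \<Longrightarrow> u x = 0"
    and D1: "open D1" "0 \<in> D1" "\<And>x. x \<in> D1 \<Longrightarrow> u x = 1"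
    and dil: "\<And>t x. 1 < t \<Longrightarrow> x \<notin> D1 \<Longrightarrow> t *\<^sub>R x \<in> D0 \<Longrightarrow> u (t *\<^sub>R x) < u x"
    and l: "0 < l" "l < 1"
  shows "strictly_starshaped (superlevel u l)"
  unfolding strictly_starshaped_def
proof (intro conjI allI impI)
  let ?U = "superlevel u l"
  have D1U: "D1 \<subseteq> ?U" using D1 l by (auto simp: superlevel_def)
  then show "0 \<in> interior ?U" using D1 interior_maximal by blast
  have cU: "closed ?U" unfolding superlevel_def by (intro closed_Collect_le continuous_intros uc)
  have fr: "u y = l" if y: "y \<in> frontier ?U" for y
  proof -
    have "y \<in> ?U" "y \<notin> interior ?U" using y cU by (auto simp: frontier_def)
    moreover have "open {x. l < u x}" by (intro open_Collect_less continuous_intros uc)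
    then have "{x. l < u x} \<subseteq> interior ?U" by (intro interior_maximal) (auto simp: superlevel_def)
    ultimately show ?thesis by (force simp: superlevel_def)
  qed
  fix v :: "real^'n" assume v: "v \<noteq> 0"
  obtain b where b: "\<And>y. y \<in> D0 \<Longrightarrow> norm y \<le> b" using D0(1) by (auto simp: bounded_iff)
  define T where "T = (\<bar>b\<bar> + 1) / norm v"
  have "norm (T *\<^sub>R v) = \<bar>b\<bar> + 1" using v by (simp add: T_def)
  then have "T *\<^sub>R v \<notin> D0" using b[of "T *\<^sub>R v"] by auto
  then have "T *\<^sub>R v \<notin> ?U" using D0(2) l by (simp add: superlevel_def)
  then have "closed_segment 0 (T *\<^sub>R v) \<inter> frontier ?U \<noteq> {}"
    using D1U D1(2) by (intro connected_Int_frontier) auto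
  then obtain e where e: "0 \<le> e" "(e * T) *\<^sub>R v \<in> frontier ?U" by (auto simp: in_segment)
  have "0 \<le> e * T" using e by (simp add: T_def)
  \<comment> \<open>Two frontier points on the ray both have value l strictly between 0 and 1, hence
    lie outside D1 and inside D0; the dilation by b/a carries one to the other and contradicts
    strictness.\<close>
  moreover have "False" if ab: "0 \<le> a" "a < b" "a *\<^sub>R v \<in> frontier ?U" "b *\<^sub>R v \<in> frontier ?U" for a b
  proof -
    have a: "u (a *\<^sub>R v) = l" and b: "u (b *\<^sub>R v) = l" using fr ab by auto
    have "a \<noteq> 0" using a D1 l by auto
    then have a0: "0 < a" using ab by simp
    have "a *\<^sub>R v \<notin> D1" using a D1(3) l by auto
    moreover have ba: "(b / a) *\<^sub>R a *\<^sub>R v = b *\<^sub>R v" using a0 by simp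
    moreover have "b *\<^sub>R v \<in> D0" using b D0(2) l by fastforce
    ultimately have "u ((b / a) *\<^sub>R a *\<^sub>R v) < u (a *\<^sub>R v)" using a0 ab by (intro dil) auto
    then show False using a b by (simp only: ba)
  qed
  then have "a = b" if "0 \<le> a" "0 \<le> b" "a *\<^sub>R v \<in> frontier ?U" "b *\<^sub>R v \<in> frontier ?U" for a b
    using that by (meson linorder_neqE_linordered_idom)
  ultimately show "\<exists>!y. y \<in> {s *\<^sub>R v |s. 0 \<le> s} \<and> y \<in> frontier ?U"
    using e(2) by (intro ex1I[of _ "(e * T) *\<^sub>R v"]) auto
qed

theorem theorem1p1:
  fixes \<alpha> :: real
    and D0 D1 :: "(real^'n) set"
    and f :: "real^'n \<Rightarrow> real \<Rightarrow> real"
  assumes "0 < \<alpha>" and "\<alpha> < 2"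
    and "open D0" and "open D1"
    and "0 \<in> D1" and "closure D1 \<subseteq> D0"
    and "uniform_exterior_cone (D0 - closure D1)"
  shows
    "(bounded D0 \<and> bounded D1 \<and> starshaped D0 \<and> starshaped D1 \<and>
      F0 (D0 - closure D1) f \<and> F1 \<alpha> (D0 - closure D1) f \<and>
      F2 (D0 - closure D1) f \<and> F3 (D0 - closure D1) f \<longrightarrow>
        (\<forall>u. solution_P \<alpha> D0 D1 f u \<and> (\<forall>x \<in> D0 - closure D1. 0 \<le> u x \<and> u x \<le> 1) \<longrightarrow>
          (\<forall>l. 0 < l \<and> l < 1 \<longrightarrow> starshaped (superlevel u l))))
     \<and>
     (bounded D0 \<and> bounded D1 \<and> strictly_starshaped D0 \<and> strictly_starshaped D1 \<and>
      F0 (D0 - closure D1) f \<and> F1 \<alpha> (D0 - closure D1) f \<and>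
      F2 (D0 - closure D1) f \<longrightarrow>
        (\<forall>u. solution_P \<alpha> D0 D1 f u \<and> (\<forall>x \<in> D0 - closure D1. 0 < u x \<and> u x < 1) \<longrightarrow>
          (\<forall>l. 0 < l \<and> l < 1 \<longrightarrow> strictly_starshaped (superlevel u l))))
     \<and>
     (D0 = UNIV \<and> bounded D1 \<and> starshaped D1 \<and>
      F0 (D0 - closure D1) f \<and> F1 \<alpha> (D0 - closure D1) f \<and>
      F2 (D0 - closure D1) f \<and> F3 (D0 - closure D1) f \<longrightarrow>
        (\<forall>u. solution_P \<alpha> D0 D1 f u \<and> (\<forall>x \<in> D0 - closure D1. 0 \<le> u x \<and> u x \<le> 1) \<longrightarrow>
          (\<forall>l. 0 < l \<and> l < 1 \<longrightarrow> starshaped (superlevel u l))))"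
proof (intro conjI allI impI; elim conjE)
  note \<alpha> = assms(1,2) and D = assms(3,4) and D1_0 = assms(5)
  \<comment> \<open>Off D0 - \<open>closure D1\<close> the boundary values 0 and 1 are prescribed,
    so the bounds hold everywhere.\<close>
  have u01: "0 \<le> u x \<and> u x \<le> 1"
    if "solution_P \<alpha> D0 D1 f u" "\<forall>x \<in> D0 - closure D1. 0 \<le> u x \<and> u x \<le> 1" for u x
    using that by (cases "x \<in> D0"; cases "x \<in> closure D1") (auto simp: solution_P_def)
  \<comment> \<open>Common to (i) and (iii): in (iii) the whole space is itself starshaped.\<close>
  have star: "starshaped (superlevel u l)"
    if "starshaped D0" "starshaped D1" "F0 (D0 - closure D1) f" "F1 \<alpha> (D0 - closure D1) f" "F3 (D0 - closure D1) f"
      and sol: "solution_P \<alpha> D0 D1 f u" "\<forall>x \<in> D0 - closure D1. 0 \<le> u x \<and> u x \<le> 1" and l: "l < 1" for u l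
  proof (rule starshaped_superlevel)
    show "u (t *\<^sub>R x) \<le> u x" if "1 < t" for t x
      by (rule dilation_le_of_monotone[OF \<alpha> D(1) _ _ _ _ _ sol(1) u01[OF sol] that]) fact+
    have "u 0 = 1" using sol(1) D1_0 closure_subset[of D1] by (auto simp: solution_P_def)
    then show "l \<le> u 0" using l by simp
  qed
  show "starshaped (superlevel u l)"
    if "starshaped D0" "starshaped D1" "F0 (D0 - closure D1) f" "F1 \<alpha> (D0 - closure D1) f" "F3 (D0 - closure D1) f"
      "solution_P \<alpha> D0 D1 f u" "\<forall>x \<in> D0 - closure D1. 0 \<le> u x \<and> u x \<le> 1" "l < 1" for u l
    using star that by blast
  show "starshaped (superlevel u l)"
    if "D0 = UNIV" "starshaped D1" "F0 (D0 - closure D1) f" "F1 \<alpha> (D0 - closure D1) f" "F3 (D0 - closure D1) f"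
      "solution_P \<alpha> D0 D1 f u" "\<forall>x \<in> D0 - closure D1. 0 \<le> u x \<and> u x \<le> 1" "l < 1" for u l
  proof -
    have "starshaped D0" using \<open>D0 = UNIV\<close> by (simp add: starshaped_def)
    then show ?thesis using star that by blast
  qed
  show "strictly_starshaped (superlevel u l)"
    if bd: "bounded D0" "bounded D1" and ss: "strictly_starshaped D0" "strictly_starshaped D1"
      and F: "F0 (D0 - closure D1) f" "F1 \<alpha> (D0 - closure D1) f" "F2 (D0 - closure D1) f"
      and sol: "solution_P \<alpha> D0 D1 f u" and u: "\<forall>x \<in> D0 - closure D1. 0 < u x \<and> u x < 1"
      and l: "0 < l" "l < 1" for u l
  proof -
    have u01': "0 \<le> u x \<and> u x \<le> 1" for x by (rule u01[OF sol]) (use u in \<open>auto intro: less_imp_le\<close>)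
    have u0: "u x = 0" if "x \<notin> D0" for x using sol that by (simp add: solution_P_def)
    have u1: "u x = 1" if "x \<in> closure D1" for x using sol that by (simp add: solution_P_def)
    have pos: "0 < u x" if "x \<in> D0" for x using u u1[of x] that by (cases "x \<in> closure D1") auto
    have less: "u x < 1" if "x \<notin> closure D1" for x using u u0[of x] that by (cases "x \<in> D0") auto
    show ?thesis
    proof (rule strictly_starshaped_superlevel[OF _ bd(1) u0 D(2) D1_0 _ _ l])
      show "continuous_on UNIV u" using sol by (simp add: solution_P_def)
      show "u x = 1" if "x \<in> D1" for x using that closure_subset[of D1] by (auto intro: u1)
      show "u (t *\<^sub>R x) < u x" if "1 < t" "x \<notin> D1" "t *\<^sub>R x \<in> D0" for t x
        using dilation_less[OF \<alpha> D(1) ss(1) bd(1) D(2) ss(2) bd(2) F sol u01' pos less that(1,2)]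
          that(3) closure_subset[of D0] by blast
    qed
  qed
qed

end
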